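(* Let $n\ge1$ and let $Q$ be a complete $\tau$-slice of an acyclic stable $n$-translation quiver $\overline Q$ (with finitely many $\tau$-orbits). Then the bound quiver $Q$ is $n$-homogeneous.
   Context: Let $k$ be a field. A bound quiver $Q=(Q_0,Q_1,\rho)$ consists of a quiver with finitely many arrows between any two vertices and a set $\rho$ of relations, each a linear combination of paths of the same length $\ge2$ with common start and common end; its algebra is $kQ/(\rho)$, graded by path length. Paths are composed right to left. A path is bound if its image in $kQ/(\rho)$ is nonzero; a bound path is maximal if it cannot be extended by an arrow on either side to a bound path. $Q$ is $n$-homogeneous if the relations can be chosen homogeneous and all maximal bound paths have the same length $n$. A stable $n$-translation quiver is a bound quiver $\overline Q=(\overline Q_0,\overline Q_1,\overline\rho)$ of a graded self-injective algebra $\overline\Lambda=k\overline Q/(\overline\rho)$ of Loewy length $n+2$; its $n$-translation $\tau$ is the Nakayama permutation, i.e. $\overline\Lambda_{n+1}e_i$ is the socle of $\overline\Lambda e_i$ and is isomorphic to the simple at $\tau^{-1}i$. A complete $\tau$-slice of $\overline Q$ is a full subquiver $Q$ such that (a) its vertex set meets each $\tau$-orbit in exactly one vertex; (b) it is convex: every path of $\overline Q$ with both ends in $Q$ lies in $Q$. It is a bound quiver with relations $\rho=\{x\in\overline\rho\mid s(x),t(x)\in Q_0\}$ (relations normalized to start and end at single vertices). *)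

theory Defs
  imports
    "Graph_Theory.Digraph_Component"
    "HOL-Algebra.QuotRing"
    "HOL-Algebra.Module"
    "HOL-Library.Poly_Mapping"
begin

section \<open>Unital modules over a ring with local units\<close>

text \<open>
  The algebra of a quiver with infinitely many vertices has no unit, so the locales of HOL-Algebra
  for rings and modules do not apply; its records, \<^const>\<open>abelian_group\<close> and \<^const>\<open>submodule\<close> do.
  Modules \<open>M\<close> are required to satisfy \<open>R M = M\<close>; over a ring with local units (or a unit) this
  says that each element of \<open>M\<close> is fixed by some element of \<open>R\<close>.
  The fields \<^const>\<open>mult\<close> and \<^const>\<open>one\<close> of a module record play no role.
\<close>

definition left_module :: "('a, 'c) ring_scheme \<Rightarrow> ('a, 'm) module \<Rightarrow> bool" where
  "left_module R M \<longleftrightarrow> abelian_group M \<and>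
    (\<forall>a\<in>carrier R. \<forall>x\<in>carrier M. a \<odot>\<^bsub>M\<^esub> x \<in> carrier M) \<and>
    (\<forall>a\<in>carrier R. \<forall>b\<in>carrier R. \<forall>x\<in>carrier M.
        (a \<oplus>\<^bsub>R\<^esub> b) \<odot>\<^bsub>M\<^esub> x = a \<odot>\<^bsub>M\<^esub> x \<oplus>\<^bsub>M\<^esub> b \<odot>\<^bsub>M\<^esub> x) \<and>
    (\<forall>a\<in>carrier R. \<forall>x\<in>carrier M. \<forall>y\<in>carrier M.
        a \<odot>\<^bsub>M\<^esub> (x \<oplus>\<^bsub>M\<^esub> y) = a \<odot>\<^bsub>M\<^esub> x \<oplus>\<^bsub>M\<^esub> a \<odot>\<^bsub>M\<^esub> y) \<and>
    (\<forall>a\<in>carrier R. \<forall>b\<in>carrier R. \<forall>x\<in>carrier M.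
        (a \<otimes>\<^bsub>R\<^esub> b) \<odot>\<^bsub>M\<^esub> x = a \<odot>\<^bsub>M\<^esub> (b \<odot>\<^bsub>M\<^esub> x)) \<and>
    (\<forall>x\<in>carrier M. \<exists>e\<in>carrier R. e \<odot>\<^bsub>M\<^esub> x = x)"

definition lmod_hom :: "('a, 'c) ring_scheme \<Rightarrow> ('a, 'm) module \<Rightarrow> ('a, 'l) module \<Rightarrow> ('m \<Rightarrow> 'l) set" where
  "lmod_hom R M N = {f. f \<in> carrier M \<rightarrow> carrier N \<and>
    (\<forall>x\<in>carrier M. \<forall>y\<in>carrier M. f (x \<oplus>\<^bsub>M\<^esub> y) = f x \<oplus>\<^bsub>N\<^esub> f y) \<and>
    (\<forall>a\<in>carrier R. \<forall>x\<in>carrier M. f (a \<odot>\<^bsub>M\<^esub> x) = a \<odot>\<^bsub>N\<^esub> f x)}"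

definition lmod_isomorphic :: "('a, 'c) ring_scheme \<Rightarrow> ('a, 'm) module \<Rightarrow> ('a, 'l) module \<Rightarrow> bool" where
  "lmod_isomorphic R M N \<longleftrightarrow> (\<exists>f\<in>lmod_hom R M N. bij_betw f (carrier M) (carrier N))"

text \<open>
  HOL cannot quantify over the carrier types of the test modules \<open>X\<close> and \<open>Y\<close>; they are the type
  of the carrier of \<open>M\<close>. This loses nothing for \<open>M = R e\<close> with an idempotent \<open>e\<close>: the
  inclusions of submodules of the modules \<open>R e'\<close> are among the tests, and by Baer's criterion
  they imply the extension property for all monomorphisms.
\<close>

definition injective_module :: "('a, 'c) ring_scheme \<Rightarrow> ('a, 'm) module \<Rightarrow> bool" where
  "injective_module R M \<longleftrightarrow> left_module R M \<and>
    (\<forall>(X :: ('a, 'm) module) (Y :: ('a, 'm) module) f g.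
       left_module R X \<longrightarrow> left_module R Y \<longrightarrow>
       f \<in> lmod_hom R X Y \<longrightarrow> inj_on f (carrier X) \<longrightarrow> g \<in> lmod_hom R X M \<longrightarrow>
       (\<exists>h\<in>lmod_hom R Y M. \<forall>x\<in>carrier X. h (f x) = g x))"

definition simple_submodule :: "('a, 'c) ring_scheme \<Rightarrow> ('a, 'm) module \<Rightarrow> 'm set \<Rightarrow> bool" where
  "simple_submodule R M S \<longleftrightarrow> submodule S R M \<and> S \<noteq> {\<zero>\<^bsub>M\<^esub>} \<and>
    (\<forall>N. submodule N R M \<longrightarrow> N \<subseteq> S \<longrightarrow> N = {\<zero>\<^bsub>M\<^esub>} \<or> N = S)"

text \<open>The sum of the simple submodules, i.e. the least submodule containing them.\<close>

definition module_socle :: "('a, 'c) ring_scheme \<Rightarrow> ('a, 'm) module \<Rightarrow> 'm set" where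
  "module_socle R M = \<Inter>{N. submodule N R M \<and> (\<forall>S. simple_submodule R M S \<longrightarrow> S \<subseteq> N)}"

definition maximal_in :: "('a, 'c) ring_scheme \<Rightarrow> ('a, 'm) module \<Rightarrow> 'm set \<Rightarrow> 'm set \<Rightarrow> bool" where
  "maximal_in R M N L \<longleftrightarrow> submodule L R M \<and> L \<subset> N \<and>
    (\<forall>L'. submodule L' R M \<longrightarrow> L \<subseteq> L' \<longrightarrow> L' \<subseteq> N \<longrightarrow> L' = L \<or> L' = N)"

text \<open>The radical of the submodule \<open>N\<close> of \<open>M\<close>; it is \<open>N\<close> if \<open>N\<close> has no maximal submodule.\<close>

definition module_radical :: "('a, 'c) ring_scheme \<Rightarrow> ('a, 'm) module \<Rightarrow> 'm set \<Rightarrow> 'm set" where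
  "module_radical R M N = N \<inter> \<Inter>{L. maximal_in R M N L}"

definition radical_power :: "('a, 'c) ring_scheme \<Rightarrow> ('a, 'm) module \<Rightarrow> nat \<Rightarrow> 'm set" where
  "radical_power R M m = (module_radical R M ^^ m) (carrier M)"

definition has_loewy_length :: "('a, 'c) ring_scheme \<Rightarrow> ('a, 'm) module \<Rightarrow> nat \<Rightarrow> bool" where
  "has_loewy_length R M l \<longleftrightarrow>
    radical_power R M l = {\<zero>\<^bsub>M\<^esub>} \<and> (\<forall>m<l. radical_power R M m \<noteq> {\<zero>\<^bsub>M\<^esub>})"

definition regular_module :: "('a, 'c) ring_scheme \<Rightarrow> ('a, 'a) module" where
  "regular_module R = \<lparr>carrier = carrier R, mult = mult R, one = one R,
     zero = zero R, add = add R, smult = mult R\<rparr>"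


section \<open>Bound quivers and their algebras\<close>

text \<open>
  A path is a pair \<open>(u, p)\<close> of its start and the list of its arrows, the arrow traversed first
  at the head of the list; \<open>(u, [])\<close> is the trivial path \<open>e\<^sub>u\<close>. Products are read right to left:
  \<open>(v, q) (u, p) = (u, p @ q)\<close> if \<open>(u, p)\<close> ends in \<open>v\<close>.
\<close>

type_synonym ('v, 'a) path = "'v \<times> 'a list"

definition paths :: "('v, 'a) pre_digraph \<Rightarrow> ('v, 'a) path set" where
  "paths G = {(u, p). \<exists>v. pre_digraph.awalk G u p v}"

definition path_mult ::
    "('v, 'a) pre_digraph \<Rightarrow> (('v, 'a) path \<Rightarrow>\<^sub>0 'k::field) \<Rightarrow> (('v, 'a) path \<Rightarrow>\<^sub>0 'k)
      \<Rightarrow> (('v, 'a) path \<Rightarrow>\<^sub>0 'k)" where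
  "path_mult G x y = (\<Sum>(v, q)\<in>Poly_Mapping.keys x. \<Sum>(u, p)\<in>Poly_Mapping.keys y.
     if pre_digraph.awlast G u p = v
     then Poly_Mapping.single (u, p @ q)
       (Poly_Mapping.lookup x (v, q) * Poly_Mapping.lookup y (u, p)) else 0)"

text \<open>
  The path algebra \<open>kQ\<close>. Its field \<^const>\<open>one\<close> is the unit if there are finitely many vertices;
  otherwise there is no unit, the sum below is \<open>0\<close>, and the field is not used.
\<close>

definition path_algebra :: "('v, 'a) pre_digraph \<Rightarrow> (('v, 'a) path \<Rightarrow>\<^sub>0 'k::field) ring" where
  "path_algebra G = \<lparr>carrier = {x. Poly_Mapping.keys x \<subseteq> paths G}, mult = path_mult G,
     one = (\<Sum>v\<in>verts G. Poly_Mapping.single (v, []) 1), zero = 0, add = (+)\<rparr>"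

definition from_to :: "('v, 'a) pre_digraph \<Rightarrow> 'v \<Rightarrow> 'v \<Rightarrow> (('v, 'a) path \<Rightarrow>\<^sub>0 'k::field) \<Rightarrow> bool" where
  "from_to G u v x \<longleftrightarrow> (\<forall>(w, p)\<in>Poly_Mapping.keys x. w = u \<and> pre_digraph.awalk G u p v)"

definition of_length :: "nat \<Rightarrow> (('v, 'a) path \<Rightarrow>\<^sub>0 'k::field) \<Rightarrow> bool" where
  "of_length m x \<longleftrightarrow> (\<forall>(w, p)\<in>Poly_Mapping.keys x. length p = m)"

definition quiver_relation :: "('v, 'a) pre_digraph \<Rightarrow> (('v, 'a) path \<Rightarrow>\<^sub>0 'k::field) \<Rightarrow> bool" where
  "quiver_relation G x \<longleftrightarrow>
    (\<exists>u\<in>verts G. \<exists>v\<in>verts G. \<exists>m\<ge>2. from_to G u v x \<and> of_length m x)"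

definition bound_quiver ::
    "('v, 'a) pre_digraph \<Rightarrow> (('v, 'a) path \<Rightarrow>\<^sub>0 'k::field) set \<Rightarrow> bool" where
  "bound_quiver G \<rho> \<longleftrightarrow> wf_digraph G \<and>
    (\<forall>u v. finite {a \<in> arcs G. tail G a = u \<and> head G a = v}) \<and>
    (\<forall>x\<in>\<rho>. quiver_relation G x)"

text \<open>
  Two-sided ideals of \<open>kQ\<close> as a ring are subspaces, since \<open>c x = (c e) x\<close> for a suitable sum \<open>e\<close>
  of trivial paths.
\<close>

definition two_sided_ideal :: "'a set \<Rightarrow> ('a, 'c) ring_scheme \<Rightarrow> bool" where
  "two_sided_ideal I R \<longleftrightarrow> subgroup I (add_monoid R) \<and>
    (\<forall>a\<in>I. \<forall>x\<in>carrier R. x \<otimes>\<^bsub>R\<^esub> a \<in> I \<and> a \<otimes>\<^bsub>R\<^esub> x \<in> I)"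

definition relation_ideal ::
    "('v, 'a) pre_digraph \<Rightarrow> (('v, 'a) path \<Rightarrow>\<^sub>0 'k::field) set \<Rightarrow> (('v, 'a) path \<Rightarrow>\<^sub>0 'k) set" where
  "relation_ideal G \<rho> = \<Inter>{I. two_sided_ideal I (path_algebra G) \<and> \<rho> \<subseteq> I}"

definition bq_algebra ::
    "('v, 'a) pre_digraph \<Rightarrow> (('v, 'a) path \<Rightarrow>\<^sub>0 'k::field) set \<Rightarrow> (('v, 'a) path \<Rightarrow>\<^sub>0 'k) set ring" where
  "bq_algebra G \<rho> = path_algebra G Quot relation_ideal G \<rho>"

definition bq_class ::
    "('v, 'a) pre_digraph \<Rightarrow> (('v, 'a) path \<Rightarrow>\<^sub>0 'k::field) set \<Rightarrow> (('v, 'a) path \<Rightarrow>\<^sub>0 'k)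
      \<Rightarrow> (('v, 'a) path \<Rightarrow>\<^sub>0 'k) set" where
  "bq_class G \<rho> x = relation_ideal G \<rho> +>\<^bsub>path_algebra G\<^esub> x"

definition bound_path ::
    "('v, 'a) pre_digraph \<Rightarrow> (('v, 'a) path \<Rightarrow>\<^sub>0 'k::field) set \<Rightarrow> ('v, 'a) path \<Rightarrow> bool" where
  "bound_path G \<rho> w \<longleftrightarrow> w \<in> paths G \<and>
    bq_class G \<rho> (Poly_Mapping.single w 1) \<noteq> \<zero>\<^bsub>bq_algebra G \<rho>\<^esub>"

text \<open>
  The condition \<open>head G a = u\<close> matters for \<open>p = []\<close>; composability of \<open>p @ [a]\<close> is part of
  \<open>(u, p @ [a])\<close> being a path.
\<close>

definition maximal_bound_path ::
    "('v, 'a) pre_digraph \<Rightarrow> (('v, 'a) path \<Rightarrow>\<^sub>0 'k::field) set \<Rightarrow> ('v, 'a) path \<Rightarrow> bool" where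
  "maximal_bound_path G \<rho> w \<longleftrightarrow> bound_path G \<rho> w \<and> (case w of (u, p) \<Rightarrow>
    \<not> (\<exists>a\<in>arcs G. bound_path G \<rho> (u, p @ [a])) \<and>
    \<not> (\<exists>a\<in>arcs G. head G a = u \<and> bound_path G \<rho> (tail G a, a # p)))"

text \<open>The relations of a bound quiver are homogeneous by definition.\<close>

definition n_homogeneous ::
    "nat \<Rightarrow> ('v, 'a) pre_digraph \<Rightarrow> (('v, 'a) path \<Rightarrow>\<^sub>0 'k::field) set \<Rightarrow> bool" where
  "n_homogeneous n G \<rho> \<longleftrightarrow>
    (\<exists>\<rho>'. bound_quiver G \<rho>' \<and> relation_ideal G \<rho>' = relation_ideal G \<rho>) \<and>
    (\<forall>u p. maximal_bound_path G \<rho> (u, p) \<longrightarrow> length p = n)"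


section \<open>Stable n-translation quivers\<close>

text \<open>The set \<open>X e\<^sub>i\<close> for a subset \<open>X\<close> of \<open>\<Lambda> = kQ/(\<rho>)\<close>.\<close>

definition times_idem ::
    "('v, 'a) pre_digraph \<Rightarrow> (('v, 'a) path \<Rightarrow>\<^sub>0 'k::field) set
      \<Rightarrow> (('v, 'a) path \<Rightarrow>\<^sub>0 'k) set set \<Rightarrow> 'v \<Rightarrow> (('v, 'a) path \<Rightarrow>\<^sub>0 'k) set set" where
  "times_idem G \<rho> X i =
    (\<lambda>x. x \<otimes>\<^bsub>bq_algebra G \<rho>\<^esub> bq_class G \<rho> (Poly_Mapping.single (i, []) 1)) ` X"

text \<open>The component \<open>\<Lambda>\<^sub>m\<close> of the grading of \<open>\<Lambda>\<close> by path length.\<close>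

definition graded_part ::
    "('v, 'a) pre_digraph \<Rightarrow> (('v, 'a) path \<Rightarrow>\<^sub>0 'k::field) set \<Rightarrow> nat
      \<Rightarrow> (('v, 'a) path \<Rightarrow>\<^sub>0 'k) set set" where
  "graded_part G \<rho> m = bq_class G \<rho> ` {x \<in> carrier (path_algebra G). of_length m x}"

text \<open>The left \<open>\<Lambda>\<close>-module \<open>\<Lambda> e\<^sub>i\<close>.\<close>

definition projective_at ::
    "('v, 'a) pre_digraph \<Rightarrow> (('v, 'a) path \<Rightarrow>\<^sub>0 'k::field) set \<Rightarrow> 'v
      \<Rightarrow> ((('v, 'a) path \<Rightarrow>\<^sub>0 'k) set, (('v, 'a) path \<Rightarrow>\<^sub>0 'k) set) module" where
  "projective_at G \<rho> i = (regular_module (bq_algebra G \<rho>))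
     \<lparr>carrier := times_idem G \<rho> (carrier (bq_algebra G \<rho>)) i\<rparr>"

text \<open>
  The one-dimensional module on which \<open>e\<^sub>j\<close> acts as the identity and all other paths act as \<open>0\<close>.
  The coefficient of \<open>e\<^sub>j\<close> is the same for all representatives of a class in \<open>kQ/(\<rho>)\<close>, as
  relations have length at least 2.
\<close>

definition simple_at :: "'v \<Rightarrow> ((('v, 'a) path \<Rightarrow>\<^sub>0 'k::field) set, 'k) module" where
  "simple_at j = \<lparr>carrier = UNIV, mult = (*), one = 1, zero = 0, add = (+),
     smult = (\<lambda>X c. Poly_Mapping.lookup (SOME x. x \<in> X) (j, []) * c)\<rparr>"

text \<open>
  With infinitely many vertices, self-injectivity means that every indecomposable projective
  \<open>\<Lambda> e\<^sub>i\<close> is injective. With finitely many, \<open>\<Lambda>\<close> is the finite direct sum of the \<open>\<Lambda> e\<^sub>i\<close>, and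
  this is the injectivity of the left module \<open>\<Lambda>\<close>.
\<close>

definition self_injective ::
    "('v, 'a) pre_digraph \<Rightarrow> (('v, 'a) path \<Rightarrow>\<^sub>0 'k::field) set \<Rightarrow> bool" where
  "self_injective G \<rho> \<longleftrightarrow>
    (\<forall>i\<in>verts G. injective_module (bq_algebra G \<rho>) (projective_at G \<rho> i))"

definition nakayama_permutation ::
    "nat \<Rightarrow> ('v, 'a) pre_digraph \<Rightarrow> (('v, 'a) path \<Rightarrow>\<^sub>0 'k::field) set \<Rightarrow> ('v \<Rightarrow> 'v) \<Rightarrow> bool" where
  "nakayama_permutation n G \<rho> \<tau> \<longleftrightarrow> bij_betw \<tau> (verts G) (verts G) \<and>
    (\<forall>i\<in>verts G.
      times_idem G \<rho> (graded_part G \<rho> (n + 1)) i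
        = module_socle (bq_algebra G \<rho>) (projective_at G \<rho> i) \<and>
      lmod_isomorphic (bq_algebra G \<rho>)
        ((projective_at G \<rho> i)\<lparr>carrier := times_idem G \<rho> (graded_part G \<rho> (n + 1)) i\<rparr>)
        (simple_at (inv_into (verts G) \<tau> i)))"

definition stable_n_translation_quiver ::
    "nat \<Rightarrow> ('v, 'a) pre_digraph \<Rightarrow> (('v, 'a) path \<Rightarrow>\<^sub>0 'k::field) set \<Rightarrow> ('v \<Rightarrow> 'v) \<Rightarrow> bool" where
  "stable_n_translation_quiver n G \<rho> \<tau> \<longleftrightarrow> bound_quiver G \<rho> \<and> self_injective G \<rho> \<and>
    has_loewy_length (bq_algebra G \<rho>) (regular_module (bq_algebra G \<rho>)) (n + 2) \<and>
    nakayama_permutation n G \<rho> \<tau>"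


section \<open>Complete slices\<close>

definition acyclic_quiver :: "('v, 'a) pre_digraph \<Rightarrow> bool" where
  "acyclic_quiver G \<longleftrightarrow> \<not> (\<exists>u p. p \<noteq> [] \<and> pre_digraph.awalk G u p u)"

text \<open>Iterates in both directions; \<open>\<tau>\<close> is only used on the vertex set, which it permutes.\<close>

definition tau_orbit :: "('v, 'a) pre_digraph \<Rightarrow> ('v \<Rightarrow> 'v) \<Rightarrow> 'v \<Rightarrow> 'v set" where
  "tau_orbit G \<tau> i = {j \<in> verts G. \<exists>h. (\<tau> ^^ h) i = j \<or> (\<tau> ^^ h) j = i}"

definition complete_tau_slice ::
    "('v, 'a) pre_digraph \<Rightarrow> ('v \<Rightarrow> 'v) \<Rightarrow> ('v, 'a) pre_digraph \<Rightarrow> bool" where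
  "complete_tau_slice G \<tau> Q \<longleftrightarrow> induced_subgraph Q G \<and>
    (\<forall>i\<in>verts G. \<exists>!j. j \<in> tau_orbit G \<tau> i \<inter> verts Q) \<and>
    (\<forall>u p v. pre_digraph.awalk G u p v \<longrightarrow> u \<in> verts Q \<longrightarrow> v \<in> verts Q
       \<longrightarrow> pre_digraph.awalk Q u p v)"

definition slice_relations ::
    "('v, 'a) pre_digraph \<Rightarrow> (('v, 'a) path \<Rightarrow>\<^sub>0 'k::field) set \<Rightarrow> ('v, 'a) pre_digraph
      \<Rightarrow> (('v, 'a) path \<Rightarrow>\<^sub>0 'k) set" where
  "slice_relations G \<rho> Q = {x \<in> \<rho>. \<exists>u\<in>verts Q. \<exists>v\<in>verts Q. from_to G u v x}"

end

theory Submission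
  imports Defs
begin

text \<open>
  Write \<open>\<Lambda> = kG/(\<rho>)\<close> and \<open>\<nu> = \<tau>\<^sup>-\<^sup>1\<close>. Three facts about \<open>\<Lambda>\<close> carry the proof.

  \<^item> A bound path of length \<open>n + 1\<close> from \<open>u\<close> ends at \<open>\<nu> u\<close>, since it lies in the socle of \<open>\<Lambda> e\<^sub>u\<close>,
    which is the simple module at \<open>\<nu> u\<close> (\<open>bound_path_ends_at_nu\<close>).
  \<^item> A bound path of length at most \<open>n\<close> can be continued by an arrow at its end: otherwise it would
    span a simple submodule of \<open>\<Lambda> e\<^sub>u\<close>, but the socle lives in degree \<open>n + 1\<close>
    (\<open>bound_path_extend_arrow\<close>).
  \<^item> A bound path is the final segment of a bound path of length \<open>n + 1\<close>
    (\<open>bound_path_extend_before\<close>). This is where self-injectivity enters: if the path \<open>x\<close> goes from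
    \<open>u\<close> to \<open>w\<close>, then \<open>\<Lambda> x\<close> maps onto the simple module at \<open>w\<close>, which is the socle of \<open>\<Lambda> e\<^sub>i\<close> for
    \<open>i = \<tau> w\<close>; the extension of this map to \<open>\<Lambda> e\<^sub>u \<rightarrow> \<Lambda> e\<^sub>i\<close> is right multiplication by some \<open>c\<close>, and
    \<open>x c\<close> has a nonzero component of degree \<open>n + 1\<close>.

  Moreover, by convexity of \<open>Q\<close>, a path of \<open>Q\<close> is bound for the slice relations iff it is bound
  in \<open>G\<close> (\<open>bound_path_Q_iff\<close>).

  Let \<open>p\<close> be a maximal bound path of \<open>Q\<close>, starting at \<open>u\<close>. If it were longer than \<open>n\<close>, its initial
  segment of length \<open>n + 1\<close> would lead from \<open>u\<close> to \<open>\<nu> u\<close>. By convexity both lie in \<open>Q\<close>, and they are in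
  the same \<open>\<tau>\<close>-orbit, so \<open>\<nu> u = u\<close>, contradicting acyclicity. If it were shorter, continue
  it in \<open>G\<close> to a bound path of length \<open>n\<close>, ending at \<open>w\<close>. The first new arrow leaves \<open>Q\<close> by maximality,
  so \<open>w\<close> is outside \<open>Q\<close> by convexity. An arrow added in front starts at \<open>\<tau> w\<close>, and \<open>\<tau> w\<close> is outside \<open>Q\<close>, again
  by maximality. But there are walks \<open>\<dots> \<rightarrow> \<tau>\<^sup>2 w \<rightarrow> \<tau> w \<rightarrow> u \<rightarrow> w \<rightarrow> \<nu> w \<rightarrow> \<dots>\<close> through the \<open>\<tau>\<close>-orbit of \<open>w\<close>. A point of
  this orbit in \<open>Q\<close> to the left of \<open>\<tau> w\<close> forces \<open>\<tau> w\<close> into \<open>Q\<close> by convexity, and one to the right of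
  \<open>w\<close> forces \<open>w\<close> into \<open>Q\<close>; so the orbit of \<open>w\<close> misses \<open>Q\<close>, which a complete slice does not allow.
\<close>

section \<open>Multiplication of paths\<close>

abbreviation keys where "keys \<equiv> Poly_Mapping.keys"
abbreviation lookup where "lookup \<equiv> Poly_Mapping.lookup"
abbreviation single where "single \<equiv> Poly_Mapping.single"

lemma poly_mapping_span_induct [consumes 1, case_names zero single add]:
  fixes x :: "'b \<Rightarrow>\<^sub>0 'c::comm_monoid_add"
  assumes "keys x \<subseteq> A" "P 0" "\<And>k c. k \<in> A \<Longrightarrow> P (single k c)" "\<And>x y. P x \<Longrightarrow> P y \<Longrightarrow> P (x + y)"
  shows "P x"
proof -
  have x: "x = (\<Sum>k\<in>keys x. single k (lookup x k))"
    by (rule poly_mapping_eqI) (auto simp: lookup_sum lookup_single when_def in_keys_iff)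
  have "P (\<Sum>k\<in>K. single k (lookup x k))" if "finite K" "K \<subseteq> A" for K
    using that by (induction K rule: finite_induct) (auto intro: assms)
  with x assms(1) show ?thesis by (metis finite_keys)
qed

lemmas poly_mapping_induct [case_names zero single add] =
  poly_mapping_span_induct[OF subset_UNIV]

text \<open>
  The projection of a linear combination of paths onto the span of the paths that satisfy \<open>K\<close>; it
  is used below for the components of given length, or of given start and end.
\<close>

definition keep :: "('b \<Rightarrow> bool) \<Rightarrow> ('b \<Rightarrow>\<^sub>0 'c::zero) \<Rightarrow> ('b \<Rightarrow>\<^sub>0 'c)" where
  "keep K x = Poly_Mapping.mapp (\<lambda>k c. if K k then c else 0) x"

lemma lookup_keep: "lookup (keep K x) k = (if K k then lookup x k else 0)"
  by (auto simp: keep_def lookup_mapp when_def in_keys_iff)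

lemma keys_keep: "keys (keep K x) = {k \<in> keys x. K k}"
  by (auto simp: in_keys_iff lookup_keep split: if_splits)

lemma keep_0 [simp]: "keep K 0 = 0"
  by (rule poly_mapping_eqI) (simp add: lookup_keep)

lemma keep_add: "keep K (x + y) = keep K x + keep K (y :: 'b \<Rightarrow>\<^sub>0 'c::monoid_add)"
  by (rule poly_mapping_eqI) (simp add: lookup_keep lookup_add)

lemma keep_minus: "keep K (- x) = - keep K (x :: 'b \<Rightarrow>\<^sub>0 'c::ab_group_add)"
  by (rule poly_mapping_eqI) (simp add: lookup_keep)

lemma keep_single: "keep K (single k c) = (if K k then single k c else 0)"
  by (rule poly_mapping_eqI) (auto simp: lookup_keep lookup_single when_def)

lemma keep_eq_self: "(\<And>k. k \<in> keys x \<Longrightarrow> K k) \<Longrightarrow> keep K x = x"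
  by (rule poly_mapping_eqI) (auto simp: lookup_keep in_keys_iff)

lemma keep_eq_0: "(\<And>k. k \<in> keys x \<Longrightarrow> \<not> K k) \<Longrightarrow> keep K x = 0"
  by (rule poly_mapping_eqI) (auto simp: lookup_keep in_keys_iff)

context pre_digraph begin

abbreviation pmult (infixl "\<star>" 70) where "x \<star> y \<equiv> path_mult G x y"

lemma path_mult_single:
  "single (v, q) a \<star> single (u, p) b =
     (if awlast u p = v then single (u, p @ q) (a * b) else 0)"
  by (auto simp: path_mult_def)

lemma path_mult_superset:
  assumes "finite A" "keys x \<subseteq> A" "finite B" "keys y \<subseteq> B"
  shows "x \<star> y = (\<Sum>(v, q)\<in>A. \<Sum>(u, p)\<in>B. if awlast u p = v
            then single (u, p @ q) (lookup x (v, q) * lookup y (u, p)) else 0)"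
proof -
  have "(\<Sum>(u, p)\<in>keys y. if awlast u p = v
            then single (u, p @ q) (lookup x (v, q) * lookup y (u, p)) else 0) =
     (\<Sum>(u, p)\<in>B. if awlast u p = v
            then single (u, p @ q) (lookup x (v, q) * lookup y (u, p)) else 0)" for v q
    by (rule sum.mono_neutral_left) (use assms in \<open>auto simp: in_keys_iff\<close>)
  then have "x \<star> y = (\<Sum>(v, q)\<in>keys x. \<Sum>(u, p)\<in>B. if awlast u p = v
            then single (u, p @ q) (lookup x (v, q) * lookup y (u, p)) else 0)"
    by (simp add: path_mult_def)
  also have "\<dots> = (\<Sum>(v, q)\<in>A. \<Sum>(u, p)\<in>B. if awlast u p = v
            then single (u, p @ q) (lookup x (v, q) * lookup y (u, p)) else 0)"
    by (rule sum.mono_neutral_left) (use assms in \<open>auto simp: in_keys_iff intro!: sum.neutral\<close>)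
  finally show ?thesis .
qed

lemma path_mult_add_left: "(x + x') \<star> y = x \<star> y + x' \<star> y"
proof -
  let ?A = "keys x \<union> keys x' \<union> keys (x + x')"
  have "z \<star> y = (\<Sum>(v, q)\<in>?A. \<Sum>(u, p)\<in>keys y. if awlast u p = v
            then single (u, p @ q) (lookup z (v, q) * lookup y (u, p)) else 0)"
    if "keys z \<subseteq> ?A" for z
    using that by (intro path_mult_superset) auto
  note this[of x] this[of x'] this[of "x + x'"]
  moreover have "keys x \<subseteq> ?A" "keys x' \<subseteq> ?A" "keys (x + x') \<subseteq> ?A"
    by auto
  ultimately show ?thesis
    by (simp only: sum.distrib[symmetric] split_beta)
      (auto intro!: sum.cong simp: lookup_add distrib_right single_add)
qed

lemma path_mult_add_right: "y \<star> (x + x') = y \<star> x + y \<star> x'"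
proof -
  let ?A = "keys x \<union> keys x' \<union> keys (x + x')"
  have "y \<star> z = (\<Sum>(v, q)\<in>keys y. \<Sum>(u, p)\<in>?A. if awlast u p = v
            then single (u, p @ q) (lookup y (v, q) * lookup z (u, p)) else 0)"
    if "keys z \<subseteq> ?A" for z
    using that by (intro path_mult_superset) auto
  note this[of x] this[of x'] this[of "x + x'"]
  moreover have "keys x \<subseteq> ?A" "keys x' \<subseteq> ?A" "keys (x + x') \<subseteq> ?A"
    by auto
  ultimately show ?thesis
    by (simp only: sum.distrib[symmetric] split_beta)
      (auto intro!: sum.cong simp: lookup_add distrib_left single_add)
qed

lemma path_mult_0 [simp]: "0 \<star> x = 0" "x \<star> 0 = 0"
  by (simp_all add: path_mult_def)

lemma path_mult_minus: "(- x) \<star> y = - (x \<star> y)" "x \<star> (- y) = - (x \<star> y)"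
  using path_mult_add_left[of x "- x" y] path_mult_add_right[of x y "- y"]
  by (simp_all add: eq_neg_iff_add_eq_0 add.commute)

lemma path_mult_diff: "(x - x') \<star> y = x \<star> y - x' \<star> y" "y \<star> (x - x') = y \<star> x - y \<star> x'"
  using path_mult_add_left[of x "- x'" y] path_mult_add_right[of y x "- x'"]
  by (simp_all add: path_mult_minus)

lemma awlast_concat: "awlast u p = v \<Longrightarrow> awlast u (p @ q) = awlast v q"
  by (induction p arbitrary: u) (auto split: if_splits)

text \<open>
  Associativity extends to formal sums of lists of arrows that do not compose, because the end of
  such a list is still determined by its last arrow.
\<close>

lemma path_mult_assoc: "(x \<star> y) \<star> z = x \<star> (y \<star> z)"
proof (induction x rule: poly_mapping_induct)
  case (single k a)
  obtain w r where k: "k = (w, r)" by force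
  show ?case
  proof (induction y rule: poly_mapping_induct)
    case (single l b)
    obtain v q where l: "l = (v, q)" by force
    show ?case
    proof (induction z rule: poly_mapping_induct)
      case (single m c)
      obtain u p where m: "m = (u, p)" by force
      show ?case by (auto simp: k l m path_mult_single awlast_concat mult.assoc)
    qed (simp_all add: path_mult_add_right)
  qed (simp_all add: path_mult_add_right path_mult_add_left)
qed (simp_all add: path_mult_add_left)
end

section \<open>Two-sided ideals of the path algebra\<close>

context wf_digraph begin

lemma keys_add_subset: "keys x \<subseteq> A \<Longrightarrow> keys y \<subseteq> A \<Longrightarrow> keys (x + y) \<subseteq> A"
  using keys_add by fast

lemma path_algebra_simps [simp]:
  "x \<in> carrier (path_algebra G) \<longleftrightarrow> keys x \<subseteq> paths G"
  "x \<oplus>\<^bsub>path_algebra G\<^esub> y = x + y"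
  "x \<otimes>\<^bsub>path_algebra G\<^esub> y = x \<star> y"
  "\<zero>\<^bsub>path_algebra G\<^esub> = 0"
  by (simp_all add: path_algebra_def)

lemma in_paths_iff: "(u, p) \<in> paths G \<longleftrightarrow> awalk u p (awlast u p)"
  by (auto simp: paths_def)

lemma paths_append:
  "(u, p) \<in> paths G \<Longrightarrow> (awlast u p, q) \<in> paths G \<Longrightarrow> (u, p @ q) \<in> paths G"
  unfolding in_paths_iff by (metis awalk_appendI awlast_concat)

lemma paths_appendD:
  "(u, p @ q) \<in> paths G \<Longrightarrow> (u, p) \<in> paths G \<and> (awlast u p, q) \<in> paths G"
  unfolding in_paths_iff by (auto simp: awlast_concat)

lemma keys_path_mult:
  assumes "keys x \<subseteq> paths G" "keys y \<subseteq> paths G"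
  shows "keys (x \<star> y) \<subseteq> paths G"
  using assms(1)
proof (induction x rule: poly_mapping_span_induct)
  case (single k a)
  obtain v q where k: "k = (v, q)" by force
  show ?case using assms(2)
  proof (induction y rule: poly_mapping_span_induct)
    case (single l b)
    with \<open>k \<in> paths G\<close> show ?case
      by (cases l) (auto simp: k path_mult_single intro: paths_append)
  next
    case (add x y)
    then show ?case by (simp add: path_mult_add_right keys_add_subset)
  qed simp_all
next
  case (add x x')
  then show ?case by (simp add: path_mult_add_left keys_add_subset)
qed simp_all

lemma abelian_group_path_algebra: "abelian_group (path_algebra G)"
proof (rule abelian_groupI)
  fix x :: "('a \<times> 'b list) \<Rightarrow>\<^sub>0 'k::field" assume "x \<in> carrier (path_algebra G)"
  then show "\<exists>y\<in>carrier (path_algebra G). y \<oplus>\<^bsub>path_algebra G\<^esub> x = \<zero>\<^bsub>path_algebra G\<^esub>"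
    by (intro bexI[of _ "- x"]) auto
qed (auto simp: add_ac keys_add_subset)

lemma a_inv_path_algebra:
  "keys x \<subseteq> paths G \<Longrightarrow> \<ominus>\<^bsub>path_algebra G\<^esub> x = - x"
  using abelian_group.minus_equality[OF abelian_group_path_algebra, of "- x" x] by simp

lemma two_sided_ideal_iff:
  "two_sided_ideal J (path_algebra G) \<longleftrightarrow>
     (\<forall>x\<in>J. keys x \<subseteq> paths G \<and> - x \<in> J) \<and> 0 \<in> J \<and> (\<forall>x\<in>J. \<forall>y\<in>J. x + y \<in> J) \<and>
     (\<forall>x\<in>J. \<forall>y. keys y \<subseteq> paths G \<longrightarrow> y \<star> x \<in> J \<and> x \<star> y \<in> J)"
  (is "?L \<longleftrightarrow> ?R")
proof
  assume ?L
  then interpret S: subgroup J "add_monoid (path_algebra G)"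
    by (simp add: two_sided_ideal_def)
  have sub: "keys x \<subseteq> paths G" if "x \<in> J" for x
    using S.mem_carrier[OF that] by simp
  have "- x \<in> J" if "x \<in> J" for x
    using S.m_inv_closed[OF that] a_inv_path_algebra[OF sub[OF that]] by (simp add: a_inv_def)
  with \<open>?L\<close> sub S.m_closed S.one_closed show ?R
    by (auto simp: two_sided_ideal_def)
next
  assume R: ?R
  have "subgroup J (add_monoid (path_algebra G))"
  proof (rule subgroup.intro)
    fix x assume "x \<in> J"
    with R a_inv_path_algebra[of x] show "inv\<^bsub>add_monoid (path_algebra G)\<^esub> x \<in> J"
      by (simp add: a_inv_def)
  qed (use R in auto)
  with R show ?L by (simp add: two_sided_ideal_def)
qed

text \<open>
  Every element of \<open>kG\<close> is a sum of multiples of paths, so it suffices to test multiplication by those.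
\<close>

lemma two_sided_idealI:
  assumes J: "\<And>x. x \<in> J \<Longrightarrow> keys x \<subseteq> paths G" "\<And>x. x \<in> J \<Longrightarrow> - x \<in> J" "0 \<in> J"
      "\<And>x y. x \<in> J \<Longrightarrow> y \<in> J \<Longrightarrow> x + y \<in> J"
    and left: "\<And>x v q c. x \<in> J \<Longrightarrow> (v, q) \<in> paths G \<Longrightarrow> single (v, q) c \<star> x \<in> J"
    and right: "\<And>x u p c. x \<in> J \<Longrightarrow> (u, p) \<in> paths G \<Longrightarrow> x \<star> single (u, p) c \<in> J"
  shows "two_sided_ideal J (path_algebra G)"
proof -
  have "y \<star> x \<in> J \<and> x \<star> y \<in> J" if "x \<in> J" "keys y \<subseteq> paths G" for x y
    using that(2)
  proof (induction y rule: poly_mapping_span_induct)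
    case (single k c)
    with that(1) show ?case by (cases k) (auto intro: left right)
  qed (auto simp: J path_mult_add_left path_mult_add_right)
  with J show ?thesis by (simp add: two_sided_ideal_iff)
qed

text \<open>
  A concatenation is trivial only if both factors are, so reading off the coefficient of \<open>e\<^sub>j\<close> is
  multiplicative. The coefficient is the scalar by which an element acts on the simple module at \<open>j\<close>.
\<close>

lemma lookup_trivial_path_mult:
  "lookup (x \<star> y) (j, []) = lookup x (j, []) * lookup y (j, [])"
proof (induction x rule: poly_mapping_induct)
  case (single k a)
  show ?case
  proof (induction y rule: poly_mapping_induct)
    case (single l b)
    show ?case by (cases k; cases l) (auto simp: path_mult_single lookup_single when_def)
  qed (auto simp: path_mult_add_right lookup_add distrib_left)
qed (auto simp: path_mult_add_left lookup_add distrib_right)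

end

section \<open>The algebra of a quiver with relations\<close>

locale quiver_algebra = wf_digraph G for G :: "('a, 'b) pre_digraph" +
  fixes \<rho> :: "(('a, 'b) path \<Rightarrow>\<^sub>0 'k::field) set"
  assumes relations: "r \<in> \<rho> \<Longrightarrow> quiver_relation G r"
begin

abbreviation ideal where "ideal \<equiv> relation_ideal G \<rho>"
abbreviation cls where "cls \<equiv> bq_class G \<rho>"
abbreviation alg where "alg \<equiv> bq_algebra G \<rho>"
abbreviation kG :: "(('a, 'b) path \<Rightarrow>\<^sub>0 'k) set" where "kG \<equiv> carrier (path_algebra G)"

lemma relations_keys:
  assumes "r \<in> \<rho>" shows "keys r \<subseteq> paths G"
  using relations[OF assms] by (fastforce simp: quiver_relation_def from_to_def paths_def)

lemma ideal_two_sided: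
  "two_sided_ideal (ideal) (path_algebra G)"
proof -
  have "two_sided_ideal {x. keys x \<subseteq> paths G} (path_algebra G)"
    unfolding two_sided_ideal_iff by (simp add: keys_path_mult keys_add_subset)
  with relations_keys have "ideal \<subseteq> {x. keys x \<subseteq> paths G}"
    unfolding relation_ideal_def by blast
  then show ?thesis
    unfolding two_sided_ideal_iff relation_ideal_def by (auto simp: two_sided_ideal_iff)
qed

lemma ideal_base: "r \<in> \<rho> \<Longrightarrow> r \<in> ideal"
  unfolding relation_ideal_def by blast

text \<open>
  The elements of the ideal with property \<open>P\<close> form an ideal containing \<open>\<rho>\<close>. The rule serves in place of
  a description of the ideal as the span of the products \<open>q r p\<close> with \<open>r \<in> \<rho>\<close>.
\<close>

lemma ideal_induct [consumes 1, case_names zero minus add rel left right]: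
  assumes "x \<in> ideal"
    and "P 0" "\<And>x. P x \<Longrightarrow> P (- x)" "\<And>x y. P x \<Longrightarrow> P y \<Longrightarrow> P (x + y)" "\<And>r. r \<in> \<rho> \<Longrightarrow> P r"
    and "\<And>x v q c. x \<in> ideal \<Longrightarrow> P x \<Longrightarrow> (v, q) \<in> paths G \<Longrightarrow> P (single (v, q) c \<star> x)"
    and "\<And>x u p c. x \<in> ideal \<Longrightarrow> P x \<Longrightarrow> (u, p) \<in> paths G \<Longrightarrow> P (x \<star> single (u, p) c)"
  shows "P x"
proof -
  have "two_sided_ideal {x \<in> ideal. P x} (path_algebra G)"
    by (rule two_sided_idealI) (use ideal_two_sided in \<open>auto simp: two_sided_ideal_iff assms(2-7)\<close>)
  moreover have "\<rho> \<subseteq> {x \<in> ideal. P x}"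
    by (auto simp: assms(5) ideal_base)
  ultimately show ?thesis using assms(1) unfolding relation_ideal_def by blast
qed

lemma ideal_keys: "x \<in> ideal \<Longrightarrow> keys x \<subseteq> paths G"
  and ideal_0 [simp]: "0 \<in> ideal"
  and ideal_minus: "x \<in> ideal \<Longrightarrow> - x \<in> ideal"
  and ideal_add: "x \<in> ideal \<Longrightarrow> y \<in> ideal \<Longrightarrow> x + y \<in> ideal"
  and ideal_mult_left: "x \<in> ideal \<Longrightarrow> keys y \<subseteq> paths G \<Longrightarrow> y \<star> x \<in> ideal"
  and ideal_mult_right: "x \<in> ideal \<Longrightarrow> keys y \<subseteq> paths G \<Longrightarrow> x \<star> y \<in> ideal"
  using ideal_two_sided by (auto simp: two_sided_ideal_iff)

lemma ideal_diff: "x \<in> ideal \<Longrightarrow> y \<in> ideal \<Longrightarrow> x - y \<in> ideal"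
  using ideal_add[of x "- y"] ideal_minus[of y] by simp

lemma ideal_lookup_trivial_path: "x \<in> ideal \<Longrightarrow> lookup x (j, []) = 0"
proof (induction x rule: ideal_induct)
  case (rel r)
  then obtain m where "m \<ge> 2" "of_length m r"
    using relations by (auto simp: quiver_relation_def)
  then show ?case by (force simp: of_length_def in_keys_iff)
qed (auto simp: relations_keys lookup_add lookup_trivial_path_mult)

abbreviation degree_part where "degree_part m \<equiv> keep (\<lambda>(u, p). length p = m)"

lemma degree_part_mult_left:
  "degree_part m (single (v, q) c \<star> x) =
     (if length q \<le> m then single (v, q) c \<star> degree_part (m - length q) x else 0)"
proof (induction x rule: poly_mapping_induct)
  case (single k b)
  show ?case by (cases k) (auto simp: path_mult_single keep_single)
qed (auto simp: path_mult_add_right keep_add)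

lemma degree_part_mult_right:
  "degree_part m (x \<star> single (u, p) c) =
     (if length p \<le> m then degree_part (m - length p) x \<star> single (u, p) c else 0)"
proof (induction x rule: poly_mapping_induct)
  case (single k b)
  show ?case by (cases k) (auto simp: path_mult_single keep_single)
qed (auto simp: path_mult_add_left keep_add)

text \<open>
  The ideal is graded because its generators are homogeneous; hence \<open>\<Lambda>\<close> inherits the grading by length.
\<close>

lemma degree_part_ideal: "x \<in> ideal \<Longrightarrow> degree_part m x \<in> ideal"
proof (induction x arbitrary: m rule: ideal_induct)
  case (rel r)
  then obtain l where l: "of_length l r"
    using relations by (auto simp: quiver_relation_def)
  show ?case
  proof (cases "l = m")
    case True
    with l have "degree_part m r = r" by (intro keep_eq_self) (auto simp: of_length_def)
    then show ?thesis using rel by (simp add: ideal_base)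
  next
    case False
    with l have "degree_part m r = 0" by (intro keep_eq_0) (auto simp: of_length_def)
    then show ?thesis by simp
  qed
next
  case (left x v q c)
  then show ?case by (auto simp: degree_part_mult_left intro!: ideal_mult_left split: if_splits)
next
  case (right x u p c)
  then show ?case by (auto simp: degree_part_mult_right intro!: ideal_mult_right split: if_splits)
qed (auto simp: relations_keys keep_add keep_minus ideal_add ideal_minus)

lemma cls_as_translate: "cls x = (\<lambda>i. i + x) ` ideal"
  by (auto simp: bq_class_def a_r_coset_def r_coset_def path_algebra_def)

lemma cls_eq_iff: "cls x = cls y \<longleftrightarrow> x - y \<in> ideal"
proof
  assume "cls x = cls y"
  moreover have "x \<in> cls x" unfolding cls_as_translate by (rule image_eqI[of _ _ 0]) auto
  ultimately obtain i where "i \<in> ideal" "x = i + y" by (auto simp: cls_as_translate)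
  then show "x - y \<in> ideal" by simp
next
  assume *: "x - y \<in> ideal"
  have "i + x \<in> (\<lambda>i. i + y) ` ideal" if "i \<in> ideal" for i
    by (rule image_eqI[of _ _ "i + (x - y)"]) (use that * in \<open>auto intro: ideal_add\<close>)
  moreover have "i + y \<in> (\<lambda>i. i + x) ` ideal" if "i \<in> ideal" for i
    by (rule image_eqI[of _ _ "i - (x - y)"]) (use that * in \<open>auto intro: ideal_diff\<close>)
  ultimately show "cls x = cls y" unfolding cls_as_translate by blast
qed

lemma mem_cls_iff: "y \<in> cls x \<longleftrightarrow> y - x \<in> ideal"
  unfolding cls_as_translate by (force simp: image_iff algebra_simps)

lemma carrier_alg: "carrier alg = cls ` kG"
  by (auto simp: bq_algebra_def FactRing_def A_RCOSETS_def RCOSETS_def bq_class_def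
      a_r_coset_def path_algebra_def)

lemma zero_alg: "\<zero>\<^bsub>alg\<^esub> = cls 0"
  by (simp add: bq_algebra_def FactRing_def cls_as_translate)

lemma cls_eq_zero_iff: "cls x = \<zero>\<^bsub>alg\<^esub> \<longleftrightarrow> x \<in> ideal"
  by (simp add: zero_alg cls_eq_iff)

lemma add_alg: "cls x \<oplus>\<^bsub>alg\<^esub> cls y = cls (x + y)"
proof -
  have "cls x \<oplus>\<^bsub>alg\<^esub> cls y = (\<Union>a\<in>cls x. \<Union>b\<in>cls y. {a + b})"
    by (simp add: bq_algebra_def FactRing_def set_add_def set_mult_def path_algebra_def)
  also have "\<dots> = cls (x + y)"
  proof (intro equalityI subsetI)
    fix z assume "z \<in> (\<Union>a\<in>cls x. \<Union>b\<in>cls y. {a + b})"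
    then obtain a b where ab: "a - x \<in> ideal" "b - y \<in> ideal" "z = a + b" by (auto simp: mem_cls_iff)
    then show "z \<in> cls (x + y)" using ideal_add[OF ab(1,2)] by (simp add: mem_cls_iff algebra_simps)
  next
    fix z assume "z \<in> cls (x + y)"
    then have "z - y \<in> cls x" "y \<in> cls y" by (auto simp: mem_cls_iff algebra_simps)
    moreover have "z = (z - y) + y" by simp
    ultimately show "z \<in> (\<Union>a\<in>cls x. \<Union>b\<in>cls y. {a + b})" by blast
  qed
  finally show ?thesis .
qed

lemma mult_alg:
  assumes "x \<in> kG" "y \<in> kG"
  shows "cls x \<otimes>\<^bsub>alg\<^esub> cls y = cls (x \<star> y)"
proof -
  have "cls (a \<star> b) = cls (x \<star> y)" if a: "a \<in> cls x" and b: "b \<in> cls y" for a b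
  proof -
    have a': "a - x \<in> ideal" and b': "b - y \<in> ideal" using a b by (auto simp: mem_cls_iff)
    have "keys b \<subseteq> paths G" using keys_add[of "b - y" y] ideal_keys[OF b'] assms by auto
    with a' b' assms have "(a - x) \<star> b \<in> ideal" "x \<star> (b - y) \<in> ideal"
      by (auto intro: ideal_mult_left ideal_mult_right)
    from ideal_add[OF this] show ?thesis by (simp add: cls_eq_iff path_mult_diff)
  qed
  moreover have "x \<in> cls x" "y \<in> cls y" by (auto simp: mem_cls_iff)
  moreover have "cls x \<otimes>\<^bsub>alg\<^esub> cls y = (\<Union>a\<in>cls x. \<Union>b\<in>cls y. cls (a \<star> b))"
    by (simp add: bq_algebra_def FactRing_def rcoset_mult_def bq_class_def path_algebra_def)
  ultimately show ?thesis by blast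
qed

lemma bound_path_iff: "bound_path G \<rho> w \<longleftrightarrow> w \<in> paths G \<and> single w 1 \<notin> ideal"
  by (simp add: bound_path_def cls_eq_zero_iff)

end

section \<open>The projective modules of the quiver algebra\<close>

lemma left_module_submodule:
  assumes M: "left_module R M" and N: "submodule N R M"
  shows "left_module R (M\<lparr>carrier := N\<rparr>)"
proof -
  interpret N: submodule N R M by (rule N)
  interpret M: abelian_group M using M by (simp add: left_module_def)
  have sub: "x \<in> carrier M" if "x \<in> N" for x
    using N.subset that by auto
  have "abelian_group (M\<lparr>carrier := N\<rparr>)"
  proof (rule abelian_groupI)
    fix x assume "x \<in> carrier (M\<lparr>carrier := N\<rparr>)"
    then have x: "x \<in> N" by simp
    then have "\<ominus>\<^bsub>M\<^esub> x \<in> N"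
      using N.m_inv_closed by (simp add: a_inv_def)
    then show "\<exists>y\<in>carrier (M\<lparr>carrier := N\<rparr>). y \<oplus>\<^bsub>M\<lparr>carrier := N\<rparr>\<^esub> x = \<zero>\<^bsub>M\<lparr>carrier := N\<rparr>\<^esub>"
      using x sub M.l_neg by (intro bexI[of _ "\<ominus>\<^bsub>M\<^esub> x"]) auto
  next
    fix x y assume "x \<in> carrier (M\<lparr>carrier := N\<rparr>)" "y \<in> carrier (M\<lparr>carrier := N\<rparr>)"
    then show "x \<oplus>\<^bsub>M\<lparr>carrier := N\<rparr>\<^esub> y = y \<oplus>\<^bsub>M\<lparr>carrier := N\<rparr>\<^esub> x"
      using sub M.a_comm by simp
  qed (use sub N.m_closed N.one_closed in \<open>simp_all add: M.a_assoc\<close>)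
  with M N.smult_closed sub show ?thesis
    by (simp add: left_module_def)
qed

context quiver_algebra begin

abbreviation proj where "proj \<equiv> projective_at G \<rho>"

definition paths_from :: "'a \<Rightarrow> ('a, 'b) path set" where
  "paths_from i = {(u, p) \<in> paths G. u = i}"

lemma paths_from_subset: "keys x \<subseteq> paths_from i \<Longrightarrow> keys x \<subseteq> paths G"
  by (auto simp: paths_from_def)

lemma trivial_path_in_paths: "(i, []) \<in> paths G \<longleftrightarrow> i \<in> verts G"
  by (auto simp: paths_def awalk_Nil_iff)

lemma path_ends_in_verts: "(u, p) \<in> paths G \<Longrightarrow> u \<in> verts G \<and> awlast u p \<in> verts G"
  unfolding in_paths_iff using awalk_hd_in_verts awalk_last_in_verts by blast

lemma trivial_path_mult_right:
  "keys x \<subseteq> paths_from i \<Longrightarrow> x \<star> single (i, []) 1 = x"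
proof (induction x rule: poly_mapping_span_induct)
  case (single k c)
  then show ?case by (cases k) (auto simp: path_mult_single paths_from_def)
qed (auto simp: path_mult_add_left)

lemma keys_trivial_path_mult_right:
  "keys x \<subseteq> paths G \<Longrightarrow> keys (x \<star> single (i, []) 1) \<subseteq> keys x \<inter> paths_from i"
proof -
  assume x: "keys x \<subseteq> paths G"
  have "x \<star> single (i, []) 1 = keep (\<lambda>k. fst k = i) x"
  proof (induction x rule: poly_mapping_induct)
    case (single k c)
    then show ?case by (cases k) (auto simp: path_mult_single keep_single)
  qed (auto simp: path_mult_add_left keep_add)
  with x show ?thesis by (auto simp: keys_keep paths_from_def)
qed

lemma keys_mult_paths_from:
  assumes "keys y \<subseteq> paths G" "keys x \<subseteq> paths_from i"
  shows "keys (y \<star> x) \<subseteq> paths_from i"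
proof (cases "i \<in> verts G")
  case True
  have "y \<star> x = (y \<star> x) \<star> single (i, []) 1"
    using assms by (simp add: path_mult_assoc trivial_path_mult_right)
  then show ?thesis
    using keys_trivial_path_mult_right[of "y \<star> x" i] keys_path_mult[OF assms(1) paths_from_subset[OF assms(2)]]
    by auto
next
  case False
  then have "paths_from i = {}" by (auto simp: paths_from_def paths_def)
  with assms show ?thesis by simp
qed

text \<open>
  Right multiplication by \<open>e\<^sub>i\<close> keeps the paths that start at \<open>i\<close>, so \<open>X e\<^sub>i\<close> consists of the classes of
  those representatives that are combinations of such paths.
\<close>

lemma times_idem_cls:
  assumes i: "i \<in> verts G" and A: "A \<subseteq> kG"
    and "\<And>x. x \<in> A \<Longrightarrow> x \<star> single (i, []) 1 \<in> A"
  shows "times_idem G \<rho> (cls ` A) i = cls ` {x \<in> A. keys x \<subseteq> paths_from i}"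
proof -
  have e: "single (i, []) 1 \<in> kG" using i by (simp add: trivial_path_in_paths)
  have "times_idem G \<rho> (cls ` A) i = (\<lambda>x. cls (x \<star> single (i, []) 1)) ` A"
    unfolding times_idem_def image_image
    by (rule image_cong) (use A e in \<open>auto simp: mult_alg\<close>)
  also have "\<dots> = cls ` {x \<in> A. keys x \<subseteq> paths_from i}"
  proof (intro equalityI subsetI)
    fix X assume "X \<in> (\<lambda>x. cls (x \<star> single (i, []) 1)) ` A"
    then obtain x where x: "x \<in> A" "X = cls (x \<star> single (i, []) 1)" by auto
    have "keys x \<subseteq> paths G" using subsetD[OF A x(1)] by simp
    then show "X \<in> cls ` {x \<in> A. keys x \<subseteq> paths_from i}"
      using x(1) keys_trivial_path_mult_right[of x i] assms(3)[of x]
      unfolding x(2) by (intro imageI) auto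
  next
    fix X assume "X \<in> cls ` {x \<in> A. keys x \<subseteq> paths_from i}"
    then obtain x where x: "x \<in> A" "keys x \<subseteq> paths_from i" "X = cls x" by auto
    then show "X \<in> (\<lambda>x. cls (x \<star> single (i, []) 1)) ` A"
      by (intro image_eqI[of _ _ x]) (simp_all add: trivial_path_mult_right)
  qed
  finally show ?thesis .
qed

lemma proj_simps [simp]:
  "add (proj i) = add alg" "zero (proj i) = zero alg" "smult (proj i) = mult alg"
  by (simp_all add: projective_at_def regular_module_def)

lemma carrier_proj: "i \<in> verts G \<Longrightarrow> carrier (proj i) = cls ` {x. keys x \<subseteq> paths_from i}"
proof -
  assume i: "i \<in> verts G"
  have "carrier (proj i) = times_idem G \<rho> (cls ` kG) i"
    by (simp add: projective_at_def carrier_alg)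
  also have "\<dots> = cls ` {x \<in> kG. keys x \<subseteq> paths_from i}"
  proof (rule times_idem_cls[OF i])
    fix x :: "('a, 'b) path \<Rightarrow>\<^sub>0 'k" assume "x \<in> kG"
    then show "x \<star> single (i, []) 1 \<in> kG"
      using keys_trivial_path_mult_right[of x i] by auto
  qed simp
  also have "{x \<in> kG. keys x \<subseteq> paths_from i} = {x. keys x \<subseteq> paths_from i}"
    by (auto simp: paths_from_def)
  finally show ?thesis .
qed

definition homogeneous_from :: "nat \<Rightarrow> 'a \<Rightarrow> (('a, 'b) path \<Rightarrow>\<^sub>0 'k) set" where
  "homogeneous_from m i = {x. keys x \<subseteq> paths_from i \<and> of_length m x}"

lemma times_idem_graded_part:
  assumes i: "i \<in> verts G"
  shows "times_idem G \<rho> (graded_part G \<rho> m) i = cls ` homogeneous_from m i"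
proof -
  have "times_idem G \<rho> (graded_part G \<rho> m) i =
      cls ` {x \<in> {x \<in> kG. of_length m x}. keys x \<subseteq> paths_from i}"
    unfolding graded_part_def
  proof (rule times_idem_cls[OF i])
    fix x assume "x \<in> {x \<in> kG. of_length m x}"
    then show "x \<star> single (i, []) 1 \<in> {x \<in> kG. of_length m x}"
      using keys_trivial_path_mult_right[of x i] by (auto simp: of_length_def)
  qed auto
  also have "{x \<in> {x \<in> kG. of_length m x}. keys x \<subseteq> paths_from i} = homogeneous_from m i"
    by (auto simp: homogeneous_from_def paths_from_def)
  finally show ?thesis .
qed

lemma degree_part_homogeneous_from: "x \<in> homogeneous_from m i \<Longrightarrow> degree_part l x = (if l = m then x else 0)"
  by (auto simp: homogeneous_from_def of_length_def intro!: keep_eq_self keep_eq_0)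

lemma cls_in_proj: "i \<in> verts G \<Longrightarrow> keys x \<subseteq> paths_from i \<Longrightarrow> cls x \<in> carrier (proj i)"
  by (simp add: carrier_proj)

text \<open>
  Closure under multiplication is only required modulo the ideal, so that the line spanned by a
  single path qualifies when all arrows annihilate its class.
\<close>

lemma submodule_cls:
  assumes i: "i \<in> verts G" and M: "left_module alg (proj i)"
    and N: "\<And>x. x \<in> N \<Longrightarrow> keys x \<subseteq> paths_from i" "0 \<in> N"
      "\<And>x y. x \<in> N \<Longrightarrow> y \<in> N \<Longrightarrow> x + y \<in> N" "\<And>x. x \<in> N \<Longrightarrow> - x \<in> N"
    and left: "\<And>x v q c. x \<in> N \<Longrightarrow> (v, q) \<in> paths G \<Longrightarrow> \<exists>y\<in>N. single (v, q) c \<star> x - y \<in> ideal"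
  shows "submodule (cls ` N) alg (proj i)"
proof -
  interpret M: abelian_group "proj i" using M by (simp add: left_module_def)
  have inv: "inv\<^bsub>add_monoid (proj i)\<^esub> cls x = cls (- x)" if "x \<in> N" for x
    unfolding a_inv_def[symmetric]
    by (rule M.minus_equality) (use that i N in \<open>auto simp: carrier_proj add_alg zero_alg\<close>)
  have mult: "\<exists>z\<in>N. y \<star> x - z \<in> ideal" if x: "x \<in> N" and y: "keys y \<subseteq> paths G" for x y
    using y
  proof (induction y rule: poly_mapping_span_induct)
    case (single k c)
    then show ?case using left[OF x] by (cases k) auto
  next
    case (add y y')
    then obtain z z' where "z \<in> N" "z' \<in> N" "y \<star> x - z \<in> ideal" "y' \<star> x - z' \<in> ideal" by auto
    then show ?case
      using ideal_add[of "y \<star> x - z" "y' \<star> x - z'"]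
      by (intro bexI[of _ "z + z'"]) (auto simp: path_mult_add_left N algebra_simps)
  next
    case zero
    show ?case using N(2) by (intro bexI[of _ 0]) auto
  qed
  show ?thesis
  proof (intro submodule.intro subgroup.intro)
    show "submodule_axioms (cls ` N) alg (proj i)"
    proof
      fix a X assume "a \<in> carrier alg" "X \<in> cls ` N"
      then obtain y x where yx: "keys y \<subseteq> paths G" "a = cls y" "x \<in> N" "X = cls x"
        by (auto simp: carrier_alg)
      with mult[of x y] obtain z where z: "z \<in> N" "y \<star> x - z \<in> ideal" by auto
      have "cls y \<otimes>\<^bsub>alg\<^esub> cls x = cls (y \<star> x)"
        using yx paths_from_subset[OF N(1)[of x]] by (intro mult_alg) auto
      with z yx show "a \<odot>\<^bsub>proj i\<^esub> X \<in> cls ` N"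
        by (auto simp: cls_eq_iff)
    qed
  qed (use N inv in \<open>auto simp: carrier_proj[OF i] add_alg zero_alg\<close>)
qed

text \<open>
  An element with nonzero class involves a path with nonzero class. This turns statements about
  elements of \<open>\<Lambda>\<close> into statements about bound paths.
\<close>

lemma keys_not_in_ideal:
  assumes "keys x \<subseteq> paths G" "x \<notin> ideal"
  shows "\<exists>k\<in>keys x. bound_path G \<rho> k"
proof (rule ccontr)
  assume "\<not> (\<exists>k\<in>keys x. bound_path G \<rho> k)"
  then have *: "keys x \<subseteq> {k \<in> paths G. single k 1 \<in> ideal}"
    using assms(1) by (auto simp: bound_path_iff)
  have "single k c \<in> ideal" if k: "k \<in> paths G" "single k 1 \<in> ideal" for k c
  proof -
    obtain u p where up: "k = (u, p)" by force
    have "single (awlast u p, []) c \<star> single k 1 \<in> ideal"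
      using k path_ends_in_verts[of u p] by (intro ideal_mult_left) (auto simp: up trivial_path_in_paths)
    then show ?thesis by (simp add: up path_mult_single)
  qed
  with * have "x \<in> ideal"
    by (induction x rule: poly_mapping_span_induct) (auto intro: ideal_add)
  with assms(2) show False by simp
qed

lemma bound_subpath:
  assumes "bound_path G \<rho> (u, r @ p @ q)"
  shows "bound_path G \<rho> (awlast u r, p)"
proof -
  let ?v = "awlast u r" let ?w = "awlast ?v p"
  have paths: "(u, r) \<in> paths G" "(?v, p) \<in> paths G" "(?w, q) \<in> paths G"
    using assms paths_appendD[of u r "p @ q"] paths_appendD[of ?v p q]
    by (auto simp: bound_path_iff)
  have "single (u, r @ p @ q) 1 = single (?w, q) 1 \<star> (single (?v, p) 1 \<star> single (u, r) 1)"
    by (simp add: path_mult_single awlast_concat)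
  moreover have "single (?w, q) 1 \<star> (single (?v, p) 1 \<star> single (u, r) 1) \<in> ideal" if "single (?v, p) 1 \<in> ideal"
    using that paths by (intro ideal_mult_left ideal_mult_right) auto
  ultimately show ?thesis using assms paths unfolding bound_path_iff by metis
qed

end

section \<open>Bound paths and the socles of the projective modules\<close>

locale translation_quiver = quiver_algebra G \<rho>
  for G :: "('a, 'b) pre_digraph" and \<rho> :: "(('a, 'b) path \<Rightarrow>\<^sub>0 'k::field) set" +
  fixes n :: nat and \<tau> :: "'a \<Rightarrow> 'a"
  assumes self_injective: "self_injective G \<rho>"
    and nakayama: "nakayama_permutation n G \<rho> \<tau>"
begin

text \<open>
  The socle of \<open>\<Lambda> e\<^sub>i\<close> is the simple module at \<open>\<nu> i\<close>.
\<close>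

abbreviation \<nu> where "\<nu> \<equiv> inv_into (verts G) \<tau>"

lemma proj_injective: "i \<in> verts G \<Longrightarrow> injective_module alg (proj i)"
  using self_injective by (simp add: self_injective_def)

lemma proj_left_module: "i \<in> verts G \<Longrightarrow> left_module alg (proj i)"
  using proj_injective by (simp add: injective_module_def)

lemma tau_nu: "i \<in> verts G \<Longrightarrow> \<tau> (\<nu> i) = i"
  and nu_tau: "i \<in> verts G \<Longrightarrow> \<nu> (\<tau> i) = i"
  and nu_verts: "i \<in> verts G \<Longrightarrow> \<nu> i \<in> verts G"
  and tau_verts: "i \<in> verts G \<Longrightarrow> \<tau> i \<in> verts G"
proof -
  have b: "bij_betw \<tau> (verts G) (verts G)"
    using nakayama by (simp add: nakayama_permutation_def)
  then show "i \<in> verts G \<Longrightarrow> \<tau> (\<nu> i) = i" "i \<in> verts G \<Longrightarrow> \<nu> (\<tau> i) = i"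
    "i \<in> verts G \<Longrightarrow> \<tau> i \<in> verts G" "i \<in> verts G \<Longrightarrow> \<nu> i \<in> verts G"
    using bij_betw_inv_into[OF b]
    by (auto simp: bij_betw_inv_into_left bij_betw_inv_into_right dest: bij_betwE)
qed

lemma socle_proj:
  assumes "i \<in> verts G"
  shows "module_socle alg (proj i) = cls ` homogeneous_from (n + 1) i"
  using nakayama assms unfolding nakayama_permutation_def times_idem_graded_part[OF assms, symmetric]
  by metis

abbreviation soc where "soc i \<equiv> cls ` homogeneous_from (n + 1) i"

text \<open>
  An isomorphism from the socle of \<open>\<Lambda> e\<^sub>i\<close> to the simple module at \<open>\<nu> i\<close>, with the action on the latter
  expressed through representatives: \<open>y\<close> acts by its coefficient at the trivial path \<open>e\<^bsub>\<nu> i\<^esub>\<close>.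
\<close>

definition socle_coordinate :: "'a \<Rightarrow> ((('a, 'b) path \<Rightarrow>\<^sub>0 'k) set \<Rightarrow> 'k) \<Rightarrow> bool" where
  "socle_coordinate i f \<longleftrightarrow> bij_betw f (soc i) UNIV \<and>
    (\<forall>X\<in>soc i. \<forall>Y\<in>soc i. f (X \<oplus>\<^bsub>alg\<^esub> Y) = f X + f Y) \<and>
    (\<forall>y X. keys y \<subseteq> paths G \<longrightarrow> X \<in> soc i \<longrightarrow>
       f (cls y \<otimes>\<^bsub>alg\<^esub> X) = lookup y (\<nu> i, []) * f X)"

lemma ex_socle_coordinate:
  assumes i: "i \<in> verts G"
  shows "\<exists>f. socle_coordinate i f"
proof -
  have "lmod_isomorphic alg ((proj i)\<lparr>carrier := soc i\<rparr>) (simple_at (\<nu> i))"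
    using nakayama i times_idem_graded_part[OF i] by (auto simp: nakayama_permutation_def)
  then obtain f where f: "f \<in> lmod_hom alg ((proj i)\<lparr>carrier := soc i\<rparr>) (simple_at (\<nu> i))"
      "bij_betw f (soc i) (UNIV :: 'k set)"
    by (auto simp: lmod_isomorphic_def simple_at_def)
  have "f (cls y \<otimes>\<^bsub>alg\<^esub> X) = lookup y (\<nu> i, []) * f X" if y: "keys y \<subseteq> paths G" and X: "X \<in> soc i" for y X
  proof -
    let ?z = "SOME z. z \<in> cls y"
    have "?z \<in> cls y" by (rule someI[of _ y]) (simp add: mem_cls_iff)
    then have "lookup ?z (\<nu> i, []) = lookup y (\<nu> i, [])"
      using ideal_lookup_trivial_path[of "?z - y" "\<nu> i"] by (simp add: mem_cls_iff lookup_minus)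
    moreover have "f (cls y \<otimes>\<^bsub>alg\<^esub> X) = lookup ?z (\<nu> i, []) * f X"
      using f(1) y X by (auto simp: lmod_hom_def simple_at_def carrier_alg)
    ultimately show ?thesis by simp
  qed
  moreover have "f (X \<oplus>\<^bsub>alg\<^esub> Y) = f X + f Y" if "X \<in> soc i" "Y \<in> soc i" for X Y
    using f(1) that by (auto simp: lmod_hom_def simple_at_def)
  ultimately show ?thesis using f(2) unfolding socle_coordinate_def by blast
qed

lemma zero_in_soc: "cls 0 \<in> soc i"
  by (simp add: homogeneous_from_def of_length_def)

lemma socle_coordinate_zero:
  assumes "socle_coordinate i f"
  shows "f (cls 0) = 0"
proof -
  have "\<forall>X\<in>soc i. \<forall>Y\<in>soc i. f (X \<oplus>\<^bsub>alg\<^esub> Y) = f X + f Y"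
    using assms unfolding socle_coordinate_def by (elim conjE)
  from this[rule_format, OF zero_in_soc zero_in_soc]
  have "f (cls 0 \<oplus>\<^bsub>alg\<^esub> cls 0) = f (cls 0) + f (cls 0)" .
  moreover have "cls 0 \<oplus>\<^bsub>alg\<^esub> cls 0 = cls 0" by (simp add: add_alg)
  ultimately show ?thesis by (metis add_cancel_right_right)
qed

lemma submodule_soc:
  assumes i: "i \<in> verts G"
  shows "submodule (soc i) alg (proj i)"
proof -
  let ?F = "{N. submodule N alg (proj i) \<and> (\<forall>S. simple_submodule alg (proj i) S \<longrightarrow> S \<subseteq> N)}"
  have M: "left_module alg (proj i)" by (rule proj_left_module[OF i])
  then interpret M: abelian_group "proj i" by (simp add: left_module_def)
  have "submodule (carrier (proj i)) alg (proj i)"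
    using M M.add.subgroup_self unfolding submodule_def submodule_axioms_def left_module_def by auto
  moreover have "S \<subseteq> carrier (proj i)" if "simple_submodule alg (proj i) S" for S
    using that subgroup.subset unfolding simple_submodule_def submodule_def by fastforce
  ultimately have "carrier (proj i) \<in> ?F" by blast
  then have "subgroup (\<Inter>?F) (add_monoid (proj i))"
    by (intro M.add.subgroups_Inter) (auto simp: submodule_def)
  moreover have "a \<odot>\<^bsub>proj i\<^esub> X \<in> \<Inter>?F" if "a \<in> carrier alg" "X \<in> \<Inter>?F" for a X
    using that submodule.smult_closed by fast
  ultimately have "submodule (\<Inter>?F) alg (proj i)"
    by (simp add: submodule_def submodule_axioms_def)
  then show ?thesis using socle_proj[OF i] by (simp add: module_socle_def)
qed

text \<open>
  If no arrow prolongs \<open>p\<close>, all paths of positive length annihilate its class, which therefore spans a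
  simple submodule. It would lie in the socle, whose elements have degree \<open>n + 1 > length p\<close>;
  as the ideal is graded, this makes the class of \<open>p\<close> zero.
\<close>

lemma bound_path_extend_arrow:
  assumes p: "bound_path G \<rho> (u, p)" and len: "length p \<le> n"
  shows "\<exists>a\<in>arcs G. bound_path G \<rho> (u, p @ [a])"
proof (rule ccontr)
  assume no: "\<not> ?thesis"
  let ?N = "range (single (u, p))"
  have up: "(u, p) \<in> paths G" and u: "u \<in> verts G"
    using p path_ends_in_verts[of u p] by (auto simp: bound_path_iff)
  have kill: "single (v, q) c \<star> single (u, p) d \<in> ideal"
    if vq: "(v, q) \<in> paths G" and q: "q \<noteq> []" for v q c d
  proof (cases "awlast u p = v")
    case True
    obtain a q' where aq: "q = a # q'" using q by (cases q) auto
    have pa: "(u, p @ [a]) \<in> paths G" "(head G a, q') \<in> paths G" "a \<in> arcs G"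
      using vq up True paths_append[of u p "[a]"] paths_appendD[of v "[a]" q'] unfolding aq
      by (auto simp: in_paths_iff awalk_Cons_iff)
    then have "single (u, p @ [a]) 1 \<in> ideal"
      using no by (auto simp: bound_path_iff)
    then have "single (head G a, q') (c * d) \<star> single (u, p @ [a]) 1 \<in> ideal"
      using pa by (intro ideal_mult_left) auto
    moreover have "single (head G a, q') (c * d) \<star> single (u, p @ [a]) 1 =
        single (v, q) c \<star> single (u, p) d"
      using True by (simp add: path_mult_single awlast_concat aq)
    ultimately show ?thesis by simp
  qed (simp add: path_mult_single)
  have sub: "submodule (cls ` ?N) alg (proj u)"
  proof (rule submodule_cls[OF u proj_left_module[OF u]])
    fix x :: "('a, 'b) path \<Rightarrow>\<^sub>0 'k" and v q c assume x: "x \<in> ?N" and vq: "(v, q) \<in> paths G"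
    then obtain d where d: "x = single (u, p) d" by auto
    show "\<exists>y\<in>?N. single (v, q) c \<star> x - y \<in> ideal"
    proof (cases "q = [] \<and> awlast u p = v")
      case True
      then show ?thesis by (intro bexI[of _ "single (u, p) (c * d)"]) (auto simp: d path_mult_single)
    next
      case False
      then have "single (v, q) c \<star> x \<in> ideal"
        using kill[OF vq] by (cases "q = []") (auto simp: d path_mult_single)
      moreover have "0 \<in> ?N" by (rule image_eqI[of _ _ 0]) auto
      ultimately show ?thesis by (intro bexI[of _ 0]) auto
    qed
  next
    show "0 \<in> ?N" by (rule image_eqI[of _ _ 0]) auto
  qed (use up in \<open>auto simp: paths_from_def single_add[symmetric] single_uminus[symmetric] split: if_splits\<close>)
  have "simple_submodule alg (proj u) (cls ` ?N)"
    unfolding simple_submodule_def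
  proof (intro conjI allI impI sub)
    have "cls (single (u, p) 1) \<noteq> \<zero>\<^bsub>alg\<^esub>"
      using p by (auto simp: bound_path_iff cls_eq_zero_iff)
    then show "cls ` ?N \<noteq> {\<zero>\<^bsub>proj u\<^esub>}" by auto
  next
    fix L assume L: "submodule L alg (proj u)" "L \<subseteq> cls ` ?N"
    interpret L: submodule L alg "proj u" by (rule L(1))
    have zero: "\<zero>\<^bsub>alg\<^esub> \<in> L" using L.one_closed by simp
    show "L = {\<zero>\<^bsub>proj u\<^esub>} \<or> L = cls ` ?N"
    proof (cases "L = {\<zero>\<^bsub>alg\<^esub>}")
      case False
      with zero obtain X where X: "X \<in> L" "X \<noteq> \<zero>\<^bsub>alg\<^esub>" by auto
      then obtain c where c: "X = cls (single (u, p) c)" using L(2) by auto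
      then have "c \<noteq> 0" using X(2) by (auto simp: zero_alg)
      have "cls (single (u, p) d) \<in> L" for d
      proof -
        let ?e = "single (awlast u p, []) (d / c)"
        have e: "?e \<in> kG" using path_ends_in_verts[OF up] by (simp add: trivial_path_in_paths)
        then have "cls ?e \<otimes>\<^bsub>alg\<^esub> X \<in> L"
          using L.smult_closed[of "cls ?e" X] X(1) by (simp add: carrier_alg)
        then show ?thesis
          using e up \<open>c \<noteq> 0\<close> by (simp add: c mult_alg path_mult_single)
      qed
      with L(2) show ?thesis by auto
    qed simp
  qed
  then have "cls ` ?N \<subseteq> module_socle alg (proj u)"
    by (auto simp: module_socle_def)
  then have "cls (single (u, p) 1) \<in> soc u"
    unfolding socle_proj[OF u] by blast
  then obtain y where y: "y \<in> homogeneous_from (n + 1) u" "cls (single (u, p) 1) = cls y"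
    by blast
  then have "degree_part (length p) (single (u, p) 1 - y) \<in> ideal"
    by (auto intro: degree_part_ideal simp: cls_eq_iff)
  moreover have "degree_part (length p) (single (u, p) 1 - y) = single (u, p) 1"
    using keep_add[of _ "single (u, p) 1" "- y"] degree_part_homogeneous_from[OF y(1)] len
    by (simp add: keep_minus keep_single)
  ultimately show False using p by (simp add: bound_path_iff)
qed

lemma bound_path_extend_after:
  assumes "bound_path G \<rho> (u, p)" "length p \<le> l" "l \<le> n + 1"
  shows "\<exists>q. bound_path G \<rho> (u, p @ q) \<and> length (p @ q) = l"
  using assms(2,3)
proof (induction l rule: dec_induct)
  case base
  show ?case using assms(1) by (intro exI[of _ "[]"]) simp
next
  case (step l)
  then obtain q where q: "bound_path G \<rho> (u, p @ q)" "length (p @ q) = l" by auto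
  then obtain a where "bound_path G \<rho> (u, (p @ q) @ [a])"
    using bound_path_extend_arrow[OF q(1)] step by auto
  with q show ?case by (intro exI[of _ "q @ [a]"]) auto
qed

text \<open>
  The trivial path at the end of \<open>p\<close> fixes the class of \<open>p\<close>, but acts as zero on the simple module at any other
  vertex.
\<close>

lemma bound_path_ends_at_nu:
  assumes p: "bound_path G \<rho> (u, p)" and len: "length p = n + 1"
  shows "awlast u p = \<nu> u"
proof (rule ccontr)
  assume ne: "awlast u p \<noteq> \<nu> u"
  have up: "(u, p) \<in> paths G" using p by (simp add: bound_path_iff)
  then have u: "u \<in> verts G" using path_ends_in_verts by blast
  obtain f where f: "socle_coordinate u f" using ex_socle_coordinate[OF u] by blast
  let ?e = "single (awlast u p, []) (1 :: 'k)" and ?x = "single (u, p) (1 :: 'k)"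
  have e: "?e \<in> kG" using path_ends_in_verts[OF up] by (simp add: trivial_path_in_paths)
  have x: "cls ?x \<in> soc u"
    using up len by (intro imageI) (simp add: homogeneous_from_def paths_from_def of_length_def)
  have "f (cls ?e \<otimes>\<^bsub>alg\<^esub> cls ?x) = 0"
    using f e x ne by (simp add: socle_coordinate_def lookup_single)
  then have "f (cls ?x) = f (cls 0)"
    using e up socle_coordinate_zero[OF f] by (simp add: mult_alg path_mult_single)
  then have "cls ?x = cls 0"
    using x f zero_in_soc unfolding socle_coordinate_def by (meson bij_betw_imp_inj_on inj_onD)
  then show False using p by (simp add: cls_eq_iff bound_path_iff)
qed

text \<open>
  The socle of \<open>\<Lambda> e\<^sub>i\<close> is nonzero, so some bound path of length \<open>n + 1\<close> starts at \<open>i\<close>.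
\<close>

lemma ex_walk_to_nu:
  assumes i: "i \<in> verts G"
  shows "\<exists>p. awalk i p (\<nu> i)"
proof -
  obtain f where f: "socle_coordinate i f" using ex_socle_coordinate[OF i] by blast
  then have "1 \<in> f ` soc i" by (simp add: socle_coordinate_def bij_betw_def)
  then obtain x where x: "x \<in> homogeneous_from (n + 1) i" "f (cls x) = 1" by auto
  then have "cls x \<noteq> cls 0" using socle_coordinate_zero[OF f] by auto
  then have "x \<notin> ideal" by (simp add: cls_eq_iff)
  then obtain k where k: "k \<in> keys x" "bound_path G \<rho> k"
    using keys_not_in_ideal[of x] x(1) paths_from_subset[of x i] by (auto simp: homogeneous_from_def)
  then obtain p where p: "k = (i, p)" "(i, p) \<in> paths G" "length p = n + 1"
    using x(1) by (cases k) (auto simp: homogeneous_from_def paths_from_def of_length_def)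
  then show ?thesis using bound_path_ends_at_nu[of i p] k by (auto simp: in_paths_iff)
qed


lemma ex_walk_from_tau_power:
  assumes "i \<in> verts G"
  shows "\<exists>p. awalk ((\<tau> ^^ h) i) p i"
proof (induction h)
  case 0
  show ?case using assms by (intro exI[of _ "[]"]) (simp add: awalk_Nil_iff)
next
  case (Suc h)
  then obtain p where p: "awalk ((\<tau> ^^ h) i) p i" by auto
  then have y: "(\<tau> ^^ h) i \<in> verts G" by auto
  then obtain q where "awalk (\<tau> ((\<tau> ^^ h) i)) q ((\<tau> ^^ h) i)"
    using ex_walk_to_nu[OF tau_verts[OF y]] nu_tau[OF y] by auto
  with p show ?case by (auto intro: awalk_appendI)
qed

text \<open>
  The mirror image of the extension at the end. The definition of the translation only concerns left modules
  \<open>\<Lambda> e\<^sub>i\<close>, so this direction is not available by symmetry and is obtained from injectivity. With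
  \<open>w\<close> the end of \<open>p\<close>, the module \<open>\<Lambda> p\<close> has the simple quotient at \<open>w\<close>, and this simple module is the
  socle of the injective module \<open>\<Lambda> e\<^bsub>\<tau> w\<^esub>\<close>.
\<close>

lemma bound_path_extend_before:
  assumes p: "bound_path G \<rho> (u, p)"
  shows "\<exists>q i. awlast i q = u \<and> bound_path G \<rho> (i, q @ p) \<and> length (q @ p) = n + 1"
proof -
  define x :: "('a, 'b) path \<Rightarrow>\<^sub>0 'k" where "x = single (u, p) 1"
  define w where "w = awlast u p"
  have up: "(u, p) \<in> paths G" using p by (simp add: bound_path_iff)
  have verts: "u \<in> verts G" "w \<in> verts G" using path_ends_in_verts[OF up] by (auto simp: w_def)
  define i where "i = \<tau> w"
  have i: "i \<in> verts G" "\<nu> i = w" using verts by (auto simp: i_def tau_verts nu_tau)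
  have x: "keys x \<subseteq> paths_from u" "keys x \<subseteq> paths G" "x \<notin> ideal"
    using p by (auto simp: x_def paths_from_def bound_path_iff)
  obtain f where f: "socle_coordinate i f" using ex_socle_coordinate[OF i(1)] by blast
  have f_bij: "bij_betw f (soc i) UNIV"
    and f_add: "\<And>X Y. X \<in> soc i \<Longrightarrow> Y \<in> soc i \<Longrightarrow> f (X \<oplus>\<^bsub>alg\<^esub> Y) = f X + f Y"
    and f_mult: "\<And>y X. keys y \<subseteq> paths G \<Longrightarrow> X \<in> soc i \<Longrightarrow> f (cls y \<otimes>\<^bsub>alg\<^esub> X) = lookup y (w, []) * f X"
    using f unfolding socle_coordinate_def i(2) by blast+
  have f_inj: "X = Y" if "f X = f Y" "X \<in> soc i" "Y \<in> soc i" for X Y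
    using f_bij that by (meson bij_betw_imp_inj_on inj_onD)
  interpret S: submodule "soc i" alg "proj i" by (rule submodule_soc[OF i(1)])

  \<comment> \<open>The representatives \<open>y p\<close> of the elements of the submodule \<open>\<Lambda> p\<close> of \<open>\<Lambda> e\<^sub>u\<close>.\<close>
  define N where "N = {y \<star> x | y. keys y \<subseteq> paths G}"
  have subN: "submodule (cls ` N) alg (proj u)"
  proof (rule submodule_cls[OF verts(1) proj_left_module[OF verts(1)]])
    fix z v q and c :: 'k assume z: "z \<in> N" and vq: "(v, q) \<in> paths G"
    then obtain y where y: "z = y \<star> x" "keys y \<subseteq> paths G" by (auto simp: N_def)
    have "keys (single (v, q) c \<star> y) \<subseteq> paths G" using vq y(2) by (intro keys_path_mult) auto
    moreover have "single (v, q) c \<star> z = (single (v, q) c \<star> y) \<star> x"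
      by (simp add: y(1) path_mult_assoc)
    ultimately have "single (v, q) c \<star> z \<in> N" unfolding N_def by blast
    then show "\<exists>y\<in>N. single (v, q) c \<star> z - y \<in> ideal" by (intro bexI) auto
  next
    show "0 \<in> N" unfolding N_def by (intro CollectI exI[of _ 0]) simp
  next
    fix z z' assume "z \<in> N" "z' \<in> N"
    then obtain y y' where "z = y \<star> x" "z' = y' \<star> x" "keys y \<subseteq> paths G" "keys y' \<subseteq> paths G"
      by (auto simp: N_def)
    then show "z + z' \<in> N" unfolding N_def
      by (intro CollectI exI[of _ "y + y'"]) (simp add: path_mult_add_left keys_add_subset)
  next
    fix z assume "z \<in> N"
    then obtain y where "z = y \<star> x" "keys y \<subseteq> paths G" by (auto simp: N_def)
    then show "- z \<in> N" unfolding N_def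
      by (intro CollectI exI[of _ "- y"]) (simp add: path_mult_minus)
  qed (use x(1) in \<open>auto simp: N_def dest: keys_mult_paths_from\<close>)
  let ?X = "(proj u)\<lparr>carrier := cls ` N\<rparr>"

  \<comment> \<open>The quotient map from \<open>\<Lambda> p\<close> to the simple module at \<open>w\<close> sends \<open>y p\<close> to the coefficient of
    \<open>e\<^sub>w\<close> in \<open>y\<close>. It is well defined, since that coefficient is visible in degree \<open>length p\<close> of \<open>y p\<close>.\<close>
  have coeff_unique: "lookup y (w, []) = lookup y' (w, [])"
    if "keys y \<subseteq> paths G" "keys y' \<subseteq> paths G" "cls (y \<star> x) = cls (y' \<star> x)" for y y'
  proof (rule ccontr)
    assume ne: "lookup y (w, []) \<noteq> lookup y' (w, [])"
    define c where "c = lookup (y - y') (w, [])"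
    have "c \<noteq> 0" using ne by (simp add: c_def lookup_minus)
    have "(y - y') \<star> x \<in> ideal" using that(3) by (simp add: cls_eq_iff path_mult_diff)
    then have "degree_part (length p) ((y - y') \<star> x) \<in> ideal" by (rule degree_part_ideal)
    moreover have "degree_part (length p) (z \<star> x) = single (u, p) (lookup z (w, []))" for z
    proof (induction z rule: poly_mapping_induct)
      case (single k c)
      show ?case by (cases k) (auto simp: x_def w_def path_mult_single keep_single lookup_single when_def)
    qed (auto simp: path_mult_add_left keep_add lookup_add single_add)
    ultimately have "single (u, p) c \<in> ideal" by (simp add: c_def)
    moreover have "keys (single (w, []) (1 / c)) \<subseteq> paths G"
      using verts(2) by (simp add: trivial_path_in_paths)
    ultimately have "single (w, []) (1 / c) \<star> single (u, p) c \<in> ideal"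
      by (rule ideal_mult_left)
    with \<open>c \<noteq> 0\<close> x(3) show False by (simp add: path_mult_single x_def w_def)
  qed
  define \<pi> where "\<pi> Z = lookup (SOME y. keys y \<subseteq> paths G \<and> Z = cls (y \<star> x)) (w, [])" for Z
  have \<pi>: "\<pi> (cls (y \<star> x)) = lookup y (w, [])" if y: "keys y \<subseteq> paths G" for y
  proof -
    let ?P = "\<lambda>y'. keys y' \<subseteq> paths G \<and> cls (y \<star> x) = cls (y' \<star> x)"
    have "?P (SOME y'. ?P y')" by (rule someI[of ?P y]) (use y in simp)
    then show ?thesis unfolding \<pi>_def by (intro coeff_unique[OF _ y]) (elim conjE, simp)+
  qed
  \<comment> \<open>Follow the quotient map by the inverse of the isomorphism \<open>f\<close> of the socle of \<open>\<Lambda> e\<^sub>i\<close>.\<close>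
  define g where "g Z = inv_into (soc i) f (\<pi> Z)" for Z
  have g_soc: "g Z \<in> soc i" and f_g: "f (g Z) = \<pi> Z" for Z
  proof -
    have "\<pi> Z \<in> f ` soc i" using f_bij by (simp only: bij_betw_def UNIV_I)
    then show "g Z \<in> soc i" "f (g Z) = \<pi> Z" unfolding g_def by (rule inv_into_into, rule f_inv_into_f)
  qed
  have g: "g \<in> lmod_hom alg ?X (proj i)"
    unfolding lmod_hom_def
  proof (intro CollectI conjI ballI)
    show "g \<in> carrier ?X \<rightarrow> carrier (proj i)" using g_soc S.subset by auto
  next
    fix Y Z assume "Y \<in> carrier ?X" "Z \<in> carrier ?X"
    then obtain y z where yz: "Y = cls (y \<star> x)" "Z = cls (z \<star> x)" "keys y \<subseteq> paths G" "keys z \<subseteq> paths G"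
      by (auto simp: N_def)
    have "g Y \<oplus>\<^bsub>alg\<^esub> g Z \<in> soc i" using S.m_closed[OF g_soc g_soc, of Y Z] by simp
    moreover have "f (g (Y \<oplus>\<^bsub>alg\<^esub> Z)) = f (g Y \<oplus>\<^bsub>alg\<^esub> g Z)"
      using yz by (simp only: f_add[OF g_soc g_soc] f_g add_alg path_mult_add_left[symmetric] \<pi>
          keys_add_subset lookup_add)
    ultimately show "g (Y \<oplus>\<^bsub>?X\<^esub> Z) = g Y \<oplus>\<^bsub>proj i\<^esub> g Z"
      using f_inj g_soc by simp
  next
    fix a Z assume "a \<in> carrier alg" "Z \<in> carrier ?X"
    then obtain y z where yz: "a = cls y" "Z = cls (z \<star> x)" "keys y \<subseteq> paths G" "keys z \<subseteq> paths G"
      by (auto simp: N_def carrier_alg)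
    have "cls y \<otimes>\<^bsub>alg\<^esub> g Z \<in> soc i"
      using S.smult_closed[of "cls y" "g Z"] g_soc yz by (simp add: carrier_alg)
    moreover have "cls y \<otimes>\<^bsub>alg\<^esub> Z = cls ((y \<star> z) \<star> x)"
      using yz x(2) by (simp add: mult_alg keys_path_mult path_mult_assoc)
    then have "f (g (cls y \<otimes>\<^bsub>alg\<^esub> Z)) = f (cls y \<otimes>\<^bsub>alg\<^esub> g Z)"
      using yz by (simp only: f_mult[OF _ g_soc] f_g \<pi> keys_path_mult lookup_trivial_path_mult)
    ultimately show "g (a \<odot>\<^bsub>?X\<^esub> Z) = a \<odot>\<^bsub>proj i\<^esub> g Z"
      using f_inj g_soc yz(1) by simp
  qed

  have "injective_module alg (proj i)" by (rule proj_injective[OF i(1)])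
  moreover have "left_module alg ?X"
    by (rule left_module_submodule[OF proj_left_module[OF verts(1)] subN])
  moreover have "(\<lambda>Z. Z) \<in> lmod_hom alg ?X (proj u)"
    using subgroup.subset[OF submodule.axioms(1)[OF subN]] by (auto simp: lmod_hom_def)
  ultimately have "\<exists>h\<in>lmod_hom alg (proj u) (proj i). \<forall>Z\<in>carrier ?X. h Z = g Z"
    using g proj_left_module[OF verts(1)] unfolding injective_module_def by (metis inj_on_id2)
  then obtain h where h: "h \<in> lmod_hom alg (proj u) (proj i)" "\<And>Z. Z \<in> cls ` N \<Longrightarrow> h Z = g Z"
    by auto
  \<comment> \<open>The extension \<open>h\<close> is right multiplication by \<open>c\<close>, where \<open>h\<close> maps the class of \<open>e\<^sub>u\<close> to that of \<open>c\<close>.\<close>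
  let ?e = "single (u, []) (1 :: 'k)"
  have e: "keys ?e \<subseteq> paths_from u" using verts by (simp add: paths_from_def trivial_path_in_paths)
  have "h (cls ?e) \<in> carrier (proj i)"
    using h(1) cls_in_proj[OF verts(1) e] by (auto simp: lmod_hom_def)
  then obtain c where c: "keys c \<subseteq> paths_from i" "h (cls ?e) = cls c"
    unfolding carrier_proj[OF i(1)] by auto
  have "cls x = cls x \<odot>\<^bsub>proj u\<^esub> cls ?e"
    using x(1,2) paths_from_subset[OF e] by (simp add: mult_alg trivial_path_mult_right)
  moreover have "h (cls x \<odot>\<^bsub>proj u\<^esub> cls ?e) = cls x \<odot>\<^bsub>proj i\<^esub> h (cls ?e)"
    using h(1) x(2) cls_in_proj[OF verts(1) e] unfolding lmod_hom_def by (auto simp: carrier_alg)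
  ultimately have hx: "h (cls x) = cls (x \<star> c)"
    using c x(2) paths_from_subset[OF c(1)] by (simp add: mult_alg)
  let ?w = "single (w, []) (1 :: 'k)"
  have w: "keys ?w \<subseteq> paths G" using verts by (simp add: trivial_path_in_paths)
  have xw: "x = ?w \<star> x" by (simp add: x_def w_def path_mult_single)
  then have "x \<in> N" using w unfolding N_def by blast
  then have gx: "g (cls x) = cls (x \<star> c)" using h(2)[of "cls x"] hx by simp
  have "f (cls (x \<star> c)) = \<pi> (cls (?w \<star> x))" using gx f_g[of "cls x"] xw by simp
  also have "\<dots> = 1" using \<pi>[OF w] by simp
  finally have f1: "f (cls (x \<star> c)) = 1" .
  have "cls (x \<star> c) \<in> soc i" using g_soc[of "cls x"] gx by simp
  \<comment> \<open>The class of \<open>p c\<close> is nonzero and has a representative of degree \<open>n + 1\<close>; hence already the part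
    of \<open>p c\<close> in this degree is not in the ideal, and a path in it is bound.\<close>
  then obtain s where s: "s \<in> homogeneous_from (n + 1) i" "cls (x \<star> c) = cls s" by auto
  have "degree_part (n + 1) (x \<star> c - s) \<in> ideal"
    using s(2) by (intro degree_part_ideal) (simp add: cls_eq_iff)
  moreover have "degree_part (n + 1) (x \<star> c - s) = degree_part (n + 1) (x \<star> c) - s"
    using keep_add[of _ "x \<star> c" "- s"] degree_part_homogeneous_from[OF s(1), of "n + 1"]
    by (simp add: keep_minus)
  ultimately have *: "degree_part (n + 1) (x \<star> c) - s \<in> ideal" by simp
  have "s \<notin> ideal"
  proof
    assume "s \<in> ideal"
    then have "cls s = cls 0" by (simp add: cls_eq_iff)
    with f1 s(2) socle_coordinate_zero[OF f] show False by simp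
  qed
  with ideal_diff[OF _ *, of "degree_part (n + 1) (x \<star> c)"]
  have "degree_part (n + 1) (x \<star> c) \<notin> ideal" by auto
  moreover have xc: "keys (x \<star> c) \<subseteq> paths G"
    using keys_path_mult[OF x(2) paths_from_subset[OF c(1)]] .
  moreover have "keys (degree_part (n + 1) (x \<star> c)) \<subseteq> paths G" using xc by (auto simp: keys_keep)
  ultimately obtain k where "k \<in> keys (degree_part (n + 1) (x \<star> c))" "bound_path G \<rho> k"
    using keys_not_in_ideal by blast
  then have k: "k \<in> keys (x \<star> c)" "length (snd k) = n + 1" "bound_path G \<rho> k"
    by (auto simp: keys_keep)
  moreover have "keys (x \<star> c) \<subseteq> {(j, q @ p) |j q. awlast j q = u}"
  proof (induction c rule: poly_mapping_induct)
    case (single l b)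
    show ?case by (cases l) (auto simp: x_def path_mult_single split: if_splits)
  qed (simp_all add: path_mult_add_right keys_add_subset)
  ultimately show ?thesis by fastforce
qed

end

section \<open>Convex subquivers\<close>

locale convex_subquiver = quiver_algebra G \<rho>
  for G :: "('a, 'b) pre_digraph" and \<rho> :: "(('a, 'b) path \<Rightarrow>\<^sub>0 'k::field) set" +
  fixes Q :: "('a, 'b) pre_digraph"
  assumes induced: "induced_subgraph Q G"
    and convex: "awalk u p v \<Longrightarrow> u \<in> verts Q \<Longrightarrow> v \<in> verts Q \<Longrightarrow> pre_digraph.awalk Q u p v"
begin

lemma subgraph: "subgraph Q G"
  using induced by (rule induced_imp_subgraph)

lemma awlast_Q: "pre_digraph.awlast Q u p = awlast u p"
  using subgraph by (auto simp: subgraph_def compatible_awalk_verts)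

lemma path_mult_Q: "path_mult Q x y = x \<star> y"
  by (simp add: path_mult_def awlast_Q)

lemma Q_awalk_iff: "pre_digraph.awalk Q u p v \<longleftrightarrow> awalk u p v \<and> u \<in> verts Q \<and> v \<in> verts Q"
proof
  assume Q: "pre_digraph.awalk Q u p v"
  interpret Q: wf_digraph Q using subgraph by (simp add: subgraph_def)
  show "awalk u p v \<and> u \<in> verts Q \<and> v \<in> verts Q"
    using subgraph_awalk_imp_awalk[OF Q subgraph] Q.awalk_hd_in_verts[OF Q] Q.awalk_last_in_verts[OF Q]
    by simp
qed (use convex in blast)

lemma from_to_Q: "u \<in> verts Q \<Longrightarrow> v \<in> verts Q \<Longrightarrow> from_to Q u v x \<longleftrightarrow> from_to G u v x"
  by (simp add: from_to_def Q_awalk_iff)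

sublocale Q: quiver_algebra Q "slice_relations G \<rho> Q"
proof (intro quiver_algebra.intro quiver_algebra_axioms.intro)
  show "wf_digraph Q" using subgraph by (simp add: subgraph_def)
  fix r assume "r \<in> slice_relations G \<rho> Q"
  then obtain u v where r: "r \<in> \<rho>" "u \<in> verts Q" "v \<in> verts Q" "from_to G u v r"
    by (auto simp: slice_relations_def)
  then obtain m where "m \<ge> 2" "of_length m r"
    using relations by (auto simp: quiver_relation_def)
  with r show "quiver_relation Q r" by (auto simp: quiver_relation_def from_to_Q)
qed

lemma paths_Q: "(u, p) \<in> paths Q \<longleftrightarrow> (u, p) \<in> paths G \<and> u \<in> verts Q \<and> awlast u p \<in> verts Q"
  by (simp add: Q.in_paths_iff in_paths_iff Q_awalk_iff awlast_Q)

lemma midpoint_in_Q: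
  assumes "awalk u p w" "awalk w q v" "u \<in> verts Q" "v \<in> verts Q"
  shows "w \<in> verts Q"
proof -
  have "awlast u p = w" using assms(1) by auto
  moreover have "awalk u (p @ q) v" using assms(1,2) by auto
  then have "pre_digraph.awalk Q u (p @ q) v" using assms(3,4) by (rule convex)
  ultimately show ?thesis by (auto simp: awlast_Q dest: Q.awalk_last_in_verts)
qed

lemma Q_ideal_subset: "x \<in> Q.ideal \<Longrightarrow> x \<in> ideal"
proof (induction x rule: Q.ideal_induct)
  case (rel r)
  then show ?case by (simp add: slice_relations_def ideal_base)
next
  case (left x v q c)
  then have "keys (single (v, q) c) \<subseteq> paths G" by (simp add: paths_Q)
  with left show ?case by (simp add: path_mult_Q ideal_mult_left)
next
  case (right x u p c)
  then have "keys (single (u, p) c) \<subseteq> paths G" by (simp add: paths_Q)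
  with right show ?case by (simp add: path_mult_Q ideal_mult_right)
qed (auto intro: ideal_add ideal_minus)

abbreviation ends_part where "ends_part u v \<equiv> keep (\<lambda>(u', p). u' = u \<and> awlast u' p = v)"

lemma ends_part_mult_left:
  "ends_part u v (single (w, q) c \<star> x) =
     (if awlast w q = v then single (w, q) c \<star> ends_part u w x else 0)"
proof (induction x rule: poly_mapping_induct)
  case (single k b)
  show ?case by (cases k) (auto simp: path_mult_single keep_single awlast_concat)
qed (auto simp: path_mult_add_right keep_add)

lemma ends_part_mult_right:
  "ends_part u v (x \<star> single (w, p) c) =
     (if w = u then ends_part (awlast u p) v x \<star> single (u, p) c else 0)"
proof (induction x rule: poly_mapping_induct)
  case (single k b)
  show ?case by (cases k) (auto simp: path_mult_single keep_single awlast_concat)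
qed (auto simp: path_mult_add_left keep_add)

text \<open>
  If a product \<open>q r p\<close> of paths and a relation starts and ends in \<open>Q\<close>, then convexity puts the ends of \<open>r\<close>,
  and then \<open>p\<close> and \<open>q\<close>, into \<open>Q\<close>. In the induction over the ideal, a factor whose inner end lies
  outside \<open>Q\<close> therefore meets only the zero component of the other factor.
\<close>

lemma ends_part_in_Q_ideal:
  "x \<in> ideal \<Longrightarrow> u \<in> verts Q \<Longrightarrow> v \<in> verts Q \<Longrightarrow> ends_part u v x \<in> Q.ideal"
proof (induction x arbitrary: u v rule: ideal_induct)
  case (rel r)
  then obtain a b where ab: "from_to G a b r"
    using relations[OF rel(1)] unfolding quiver_relation_def by blast
  show ?case
  proof (cases "a = u \<and> b = v")
    case True
    with ab have "ends_part u v r = r" by (intro keep_eq_self) (auto simp: from_to_def)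
    moreover have "r \<in> slice_relations G \<rho> Q"
      using True ab rel by (auto simp: slice_relations_def)
    ultimately show ?thesis by (simp add: Q.ideal_base)
  next
    case False
    with ab have "ends_part u v r = 0" by (intro keep_eq_0) (auto simp: from_to_def)
    then show ?thesis by simp
  qed
next
  case (left x w q c)
  show ?case
  proof (cases "awlast w q = v")
    case True
    show ?thesis
    proof (cases "w \<in> verts Q")
      case wQ: True
      have "keys (single (w, q) c) \<subseteq> paths Q" using left wQ True by (simp add: paths_Q)
      then show ?thesis
        using True Q.ideal_mult_left[OF left.IH[OF left.prems(1) wQ]]
        by (simp add: ends_part_mult_left path_mult_Q)
    next
      case False
      have "ends_part u w x = 0"
      proof (rule keep_eq_0, clarify)
        fix p assume "(u, p) \<in> keys x" "w = awlast u p"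
        then have "awalk u p w" using ideal_keys[OF left.hyps(1)] by (auto simp: in_paths_iff)
        moreover have "awalk w q v" using left.hyps(2) True by (simp add: in_paths_iff)
        ultimately show False using midpoint_in_Q False left.prems by blast
      qed
      then show ?thesis by (simp add: ends_part_mult_left)
    qed
  qed (simp add: ends_part_mult_left)
next
  case (right x w p c)
  show ?case
  proof (cases "w = u")
    case True
    let ?w = "awlast u p"
    show ?thesis
    proof (cases "?w \<in> verts Q")
      case wQ: True
      have "keys (single (u, p) c) \<subseteq> paths Q" using right wQ True by (simp add: paths_Q)
      then show ?thesis
        using True Q.ideal_mult_right[OF right.IH[OF wQ right.prems(2)]]
        by (simp add: ends_part_mult_right path_mult_Q)
    next
      case False
      have "ends_part ?w v x = 0"
      proof (rule keep_eq_0, clarify)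
        fix q assume "(?w, q) \<in> keys x" "v = awlast ?w q"
        then have "awalk ?w q v" using ideal_keys[OF right.hyps(1)] by (auto simp: in_paths_iff)
        moreover have "awalk u p ?w" using right.hyps(2) True by (simp add: in_paths_iff)
        ultimately show False using midpoint_in_Q False right.prems by blast
      qed
      then show ?thesis by (simp add: ends_part_mult_right)
    qed
  qed (simp add: ends_part_mult_right)
qed (auto simp: keep_add keep_minus Q.ideal_add Q.ideal_minus)

lemma bound_path_Q_iff:
  "bound_path Q (slice_relations G \<rho> Q) (u, p) \<longleftrightarrow>
     bound_path G \<rho> (u, p) \<and> u \<in> verts Q \<and> awlast u p \<in> verts Q"
proof -
  have "ends_part u (awlast u p) (single (u, p) 1) = single (u, p) (1 :: 'k)"
    by (rule keep_eq_self) (auto split: if_splits)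
  then show ?thesis
    unfolding Q.bound_path_iff bound_path_iff paths_Q
    using Q_ideal_subset[of "single (u, p) 1"] ends_part_in_Q_ideal[of "single (u, p) 1" u "awlast u p"]
    by auto
qed

end

section \<open>Maximal bound paths of a complete slice\<close>

theorem lemma6p1:
  fixes G Q :: "('v, 'a) pre_digraph"
    and \<rho> :: "(('v, 'a) path \<Rightarrow>\<^sub>0 'k::field) set"
    and \<tau> :: "'v \<Rightarrow> 'v"
    and n :: nat
  assumes "n \<ge> 1"
    and "stable_n_translation_quiver n G \<rho> \<tau>"
    and "acyclic_quiver G"
    and "finite (tau_orbit G \<tau> ` verts G)"
    and "complete_tau_slice G \<tau> Q"
  shows "n_homogeneous n Q (slice_relations G \<rho> Q)"
proof -
  have bq: "bound_quiver G \<rho>"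
    using assms(2) by (simp add: stable_n_translation_quiver_def)
  interpret translation_quiver G \<rho> n \<tau>
    by (intro translation_quiver.intro translation_quiver_axioms.intro
        quiver_algebra.intro quiver_algebra_axioms.intro)
      (use assms(2) bq in \<open>simp_all add: stable_n_translation_quiver_def bound_quiver_def\<close>)
  interpret convex_subquiver G \<rho> Q
  proof
    show "induced_subgraph Q G" using assms(5) by (simp add: complete_tau_slice_def)
    show "\<And>u p v. awalk u p v \<Longrightarrow> u \<in> verts Q \<Longrightarrow> v \<in> verts Q \<Longrightarrow> pre_digraph.awalk Q u p v"
      using assms(5) by (simp add: complete_tau_slice_def)
  qed
  let ?\<rho> = "slice_relations G \<rho> Q"
  have QG: "verts Q \<subseteq> verts G" "arcs Q = {a \<in> arcs G. tail G a \<in> verts Q \<and> head G a \<in> verts Q}"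
    "tail Q = tail G" "head Q = head G"
    using induced unfolding induced_subgraph_def subgraph_def compatible_def by metis+
  have "bound_quiver Q ?\<rho>"
    unfolding bound_quiver_def
  proof (intro conjI allI ballI)
    fix u v
    have "finite {a \<in> arcs G. tail G a = u \<and> head G a = v}"
      using bq by (simp add: bound_quiver_def)
    then show "finite {a \<in> arcs Q. tail Q a = u \<and> head Q a = v}"
      by (rule rev_finite_subset) (auto simp: QG)
  qed (use Q.wf_digraph_axioms Q.relations in auto)
  moreover have "length p = n" if max: "maximal_bound_path Q ?\<rho> (u, p)" for u p
  proof -
    let ?v = "awlast u p"
    have bnd: "bound_path G \<rho> (u, p)" and u: "u \<in> verts Q" "u \<in> verts G" and v: "?v \<in> verts Q"
      using max QG(1) by (auto simp: maximal_bound_path_def bound_path_Q_iff)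
    have walk: "awalk u p ?v" using bnd by (simp add: bound_path_iff in_paths_iff)
    have after: "\<not> (bound_path G \<rho> (u, p @ [a]) \<and> head G a \<in> verts Q)" for a
    proof
      assume *: "bound_path G \<rho> (u, p @ [a]) \<and> head G a \<in> verts Q"
      then have "(?v, [a]) \<in> paths G"
        using paths_appendD[of u p "[a]"] by (simp add: bound_path_iff)
      then have "awalk ?v [a] (head G a)" by (simp add: in_paths_iff)
      then have "a \<in> arcs Q" "awlast u (p @ [a]) = head G a"
        using * v by (simp_all add: QG(2) awalk_Cons_iff awlast_concat)
      with * max u(1) show False
        by (metis (no_types, lifting) bound_path_Q_iff case_prodD maximal_bound_path_def)
    qed
    have before: "\<not> (bound_path G \<rho> (tail G a, a # p) \<and> head G a = u \<and> tail G a \<in> verts Q)" for a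
    proof
      assume *: "bound_path G \<rho> (tail G a, a # p) \<and> head G a = u \<and> tail G a \<in> verts Q"
      then have "a \<in> arcs Q" "awlast (tail G a) (a # p) = ?v"
        using u by (simp_all add: QG(2) bound_path_iff in_paths_iff awalk_Cons_iff)
      with * max v show False by (simp add: maximal_bound_path_def bound_path_Q_iff QG(3,4)) blast
    qed
    have not_gt: "\<not> length p > n"
    proof
      assume "length p > n"
      \<comment> \<open>The initial segment of length \<open>n + 1\<close> joins two vertices of \<open>Q\<close> in one \<open>\<tau>\<close>-orbit.\<close>
      define q where "q = take (n + 1) p"
      have q: "length q = n + 1" "p = q @ drop (n + 1) p"
        using \<open>length p > n\<close> by (simp_all add: q_def)
      have bq: "bound_path G \<rho> (u, q)"
        using bound_subpath[of u "[]" q "drop (n + 1) p"] bnd q by simp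
      then have nu: "awlast u q = \<nu> u" using q(1) by (rule bound_path_ends_at_nu)
      have walk_q: "awalk u q (\<nu> u)" using bq nu by (simp add: bound_path_iff in_paths_iff)
      have "awalk (\<nu> u) (drop (n + 1) p) ?v" using walk q(2) nu by (metis awalk_append_iff awlast_concat)
      then have "\<nu> u \<in> verts Q" using midpoint_in_Q walk_q u(1) v by blast
      moreover have "(\<tau> ^^ 0) u = u" "(\<tau> ^^ 1) (\<nu> u) = u"
        using u(2) by (simp_all add: tau_nu)
      then have "u \<in> tau_orbit G \<tau> u" "\<nu> u \<in> tau_orbit G \<tau> u"
        unfolding tau_orbit_def using u(2) nu_verts by blast+
      moreover have "\<exists>!j. j \<in> tau_orbit G \<tau> u \<inter> verts Q"
        using assms(5) u(2) by (simp add: complete_tau_slice_def)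
      ultimately have "\<nu> u = u" using u(1) by blast
      with walk_q have "awalk u q u" by simp
      moreover have "q \<noteq> []" using q(1) by auto
      ultimately show False using assms(3) unfolding acyclic_quiver_def by blast
    qed
    moreover have "\<not> length p < n"
    proof
      assume "length p < n"
      then obtain q where q: "bound_path G \<rho> (u, p @ q)" "length (p @ q) = n"
        using bound_path_extend_after[OF bnd, of n] by auto
      with \<open>length p < n\<close> obtain a q' where aq: "q = a # q'" by (cases q) auto
      define w where "w = awlast u (p @ q)"
      have walks: "awalk u (p @ [a]) (head G a)" "awalk (head G a) q' w" "awalk u (p @ q) w"
        using q(1) unfolding w_def aq
        by (auto simp: bound_path_iff in_paths_iff awlast_concat awalk_Cons_iff awalk_Nil_iff)
      have "bound_path G \<rho> (u, p @ [a])"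
        using bound_subpath[of u "[]" "p @ [a]" q'] q(1) aq by simp
      with after have "head G a \<notin> verts Q" by blast
      then have wQ: "w \<notin> verts Q" using midpoint_in_Q walks(1,2) u(1) by blast
      have wG: "w \<in> verts G" using walks(3) by auto
      obtain r i where r: "awlast i r = u" "bound_path G \<rho> (i, r @ p @ q)" "length (r @ p @ q) = n + 1"
        using bound_path_extend_before[OF q(1)] by auto
      with q(2) obtain b where b: "r = [b]" by (cases r) auto
      have "w = \<nu> i"
        using bound_path_ends_at_nu[OF r(2,3)] r(1) by (simp add: w_def awlast_concat)
      moreover have iG: "i \<in> verts G" and ib: "tail G b = i" "head G b = u" "awalk i [b] u"
        using r b path_ends_in_verts[of i "r @ p @ q"]
        by (auto simp: bound_path_iff in_paths_iff awalk_Cons_iff awalk_Nil_iff)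
      ultimately have i: "i = \<tau> w" using tau_nu by simp
      \<comment> \<open>Since \<open>\<tau> w\<close> is the start of an arrow that extends \<open>p\<close> to a bound path, it is not in \<open>Q\<close>.\<close>
      have "bound_path G \<rho> (tail G b, b # p)"
        using bound_subpath[of i "[]" "b # p" q] r(2) b ib by simp
      with before ib have iQ: "i \<notin> verts Q" by blast
      obtain j where j: "j \<in> tau_orbit G \<tau> w" "j \<in> verts Q"
        using assms(5) wG unfolding complete_tau_slice_def by blast
      then obtain h where orbit: "(\<tau> ^^ h) w = j \<or> (\<tau> ^^ h) j = w" and jG: "j \<in> verts G"
        by (auto simp: tau_orbit_def)
      from orbit show False
      proof
        \<comment> \<open>Here \<open>j \<rightarrow> \<tau> w \<rightarrow> u\<close>, where \<open>h \<noteq> 0\<close> because \<open>w\<close> is not in \<open>Q\<close>.\<close>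
        assume h: "(\<tau> ^^ h) w = j"
        then obtain h' where "h = Suc h'" using wQ j(2) by (cases h) auto
        then have "j = (\<tau> ^^ h') i" using h i by (simp add: funpow_swap1)
        then obtain s where "awalk j s i" using ex_walk_from_tau_power[OF iG] by blast
        then have "i \<in> verts Q" using midpoint_in_Q ib(3) j(2) u(1) by blast
        with iQ show False by simp
      next
        \<comment> \<open>Here \<open>u \<rightarrow> w \<rightarrow> j\<close>.\<close>
        assume "(\<tau> ^^ h) j = w"
        then obtain s where "awalk w s j" using ex_walk_from_tau_power[OF jG] by blast
        then have "w \<in> verts Q" using midpoint_in_Q walks(3) j(2) u(1) by blast
        with wQ show False by simp
      qed
    qed
    ultimately show ?thesis by simp
  qed
  ultimately show ?thesis unfolding n_homogeneous_def by blast
qed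

end
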